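(* Let $p\in(1,\infty)\setminus\{2\}$. Then there exist $c_p\in(0,1)$ and a constant $C_p>0$, both depending only on $p$, such that the following is true. Let $\mathfrak m\colon\mathbb R\to\mathbb C$ be a Schwartz function supported on $[-1/2,1/2]$ with $\mathfrak m(0)=1$, and let $(\varepsilon_N)_{N\in\mathbb N}$ be a given sequence of real numbers with $0<\varepsilon_N\le N^{-2}$ for every $N$. Then, for infinitely many $N\in\mathbb N$, $$\bigl\|\mathcal F_{\mathbb Z}^{-1}\bigl(\Delta_{\varepsilon_N,\mathcal R_{\le N}}[\mathfrak m]\,\mathcal F_{\mathbb Z}(\cdot)\bigr)\bigr\|_{\ell^p(\mathbb Z)\to\ell^p(\mathbb Z)}\ \ge\ C_p\,N^{c_p/\log\log N}.$$
   Context: $\mathbb N=\{1,2,\ldots\}$, $\mathbb T=\mathbb R/\mathbb Z$, and $e(z)=e^{2\pi i z}$. The space $\ell^p(\mathbb Z)$ is taken with respect to counting measure. Fourier transform on $\mathbb Z$: for $f\in\ell^1(\mathbb Z)$, $\mathcal F_{\mathbb Z}f(\xi)=\sum_{x\in\mathbb Z}f(x)e(-x\xi)$ for $\xi\in\mathbb T$. It extends to a unitary map $\ell^2(\mathbb Z)\to L^2(\mathbb T)$, whose inverse is $\mathcal F_{\mathbb Z}^{-1}g(x)=\int_{\mathbb T}g(\xi)e(x\xi)\,d\xi$. Canonical fractions: for an integer $N\ge1$, $$\mathcal R_{\le N}=\Bigl\{\tfrac aq\in\mathbb Q/\mathbb Z:\ a\in\mathbb Z,\ q\in\{1,\ldots,N\},\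 (a,q)=1\Bigr\},$$ where $(a,q)$ is the greatest common divisor. This is a finite subset of $\mathbb T$. Multiplier: for $\varepsilon\in(0,1]$ and $\mathfrak m$ supported in $[-1/2,1/2]$, $$\Delta_{\varepsilon,\mathcal R_{\le N}}[\mathfrak m](\xi)=\sum_{a/q\in\mathcal R_{\le N}}\mathfrak m\bigl(\varepsilon^{-1}(\xi-a/q)\bigr),\qquad \xi\in\mathbb T,$$ where $\xi-a/q$ is understood modulo $1$, that is, as its representative in $[-1/2,1/2)$. Operator norm: $\|\mathcal F_{\mathbb Z}^{-1}(\Delta\,\mathcal F_{\mathbb Z}(\cdot))\|_{\ell^p(\mathbb Z)\to\ell^p(\mathbb Z)}$ is the supremum of $\|\mathcal F_{\mathbb Z}^{-1}(\Delta\,\mathcal F_{\mathbb Z}f)\|_{\ell^p(\mathbb Z)}$ over $f\in\ell^2(\mathbb Z)\cap\ell^p(\mathbb Z)$ with $\|f\|_{\ell^p(\mathbb Z)}\leq 1$. *)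

theory Defs
  imports "HOL-Analysis.Analysis"
begin

definition e_char :: "real \<Rightarrow> complex" where
  "e_char z = exp (2 * of_real pi * \<i> * of_real z)"

text \<open>
  The torus \<open>\<real>/\<int>\<close> is represented by its fundamental domain \<open>[-1/2, 1/2)\<close>; \<open>torus_rep\<close> is
  reduction modulo 1 into that domain. Functions on the torus are functions on the reals of which
  only the values on the fundamental domain matter.
\<close>

definition torus_rep :: "real \<Rightarrow> real" where
  "torus_rep x = x - of_int \<lfloor>x + 1/2\<rfloor>"

definition torus :: "real measure" where
  "torus = restrict_space lborel {-1/2..<1/2}"

lemma torus_rep_range: "torus_rep x \<in> {-1/2..<1/2}"
  unfolding torus_rep_def atLeastLessThan_iff by linarith

definition lp_norm :: "real \<Rightarrow> (int \<Rightarrow> complex) \<Rightarrow> ennreal" where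
  "lp_norm p f =
     (if (\<lambda>x. cmod (f x) powr p) summable_on UNIV
      then ennreal ((\<Sum>\<^sub>\<infinity>x. cmod (f x) powr p) powr (1/p)) else \<infinity>)"

definition fourier_Z_l1 :: "(int \<Rightarrow> complex) \<Rightarrow> real \<Rightarrow> complex" where
  "fourier_Z_l1 f \<xi> = (\<Sum>\<^sub>\<infinity>x. f x * e_char (- (of_int x * \<xi>)))"

text \<open>
  The extension of the Fourier transform to \<open>\<ell>\<^sup>2\<close>: the \<open>L\<^sup>2\<close>-limit of the transforms of the
  truncations of \<open>f\<close> to \<open>[-n, n]\<close>. The limit is determined up to null sets only, and
  \<open>fourier_Z f\<close> is an arbitrary representative of it.
\<close>

definition L2_torus :: "(real \<Rightarrow> complex) set" where
  "L2_torus = {g \<in> borel_measurable torus. integrable torus (\<lambda>\<xi>. (cmod (g \<xi>))\<^sup>2)}"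

definition is_fourier_Z :: "(int \<Rightarrow> complex) \<Rightarrow> (real \<Rightarrow> complex) \<Rightarrow> bool" where
  "is_fourier_Z f g \<longleftrightarrow> g \<in> L2_torus \<and>
     (\<lambda>n::nat. LINT \<xi>|torus.
        (cmod (fourier_Z_l1 (\<lambda>x. if \<bar>x\<bar> \<le> int n then f x else 0) \<xi> - g \<xi>))\<^sup>2) \<longlonglongrightarrow> 0"

definition fourier_Z :: "(int \<Rightarrow> complex) \<Rightarrow> real \<Rightarrow> complex" where
  "fourier_Z f = (SOME g. is_fourier_Z f g)"

definition fourier_Z_inv :: "(real \<Rightarrow> complex) \<Rightarrow> int \<Rightarrow> complex" where
  "fourier_Z_inv g x = (LINT \<xi>|torus. g \<xi> * e_char (of_int x * \<xi>))"

definition canonical_fractions :: "nat \<Rightarrow> real set" where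
  "canonical_fractions N =
     {torus_rep (of_int a / of_nat q) | (a::int) (q::nat). q \<in> {1..N} \<and> coprime a (int q)}"

lemma finite_canonical_fractions: "finite (canonical_fractions N)"
proof (rule finite_subset)
  show "canonical_fractions N \<subseteq>
      (\<lambda>(b, q). of_int b / of_nat q) ` ({- int N..int N} \<times> {1..N})"
  proof
    fix r assume "r \<in> canonical_fractions N"
    then obtain a q where r: "r = torus_rep (of_int a / of_nat q)" and q: "q \<in> {1..N}"
      unfolding canonical_fractions_def by blast
    define b where "b = a - \<lfloor>of_int a / of_nat q + (1/2::real)\<rfloor> * int q"
    have q0: "real q > 0" using q by simp
    have rb: "r = of_int b / of_nat q"
      using q0 by (simp add: r torus_rep_def b_def field_simps)
    have "\<bar>r\<bar> \<le> 1"
      using torus_rep_range[of "of_int a / of_nat q"] unfolding r by auto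
    then have "\<bar>of_int b :: real\<bar> \<le> real q"
      using q0 by (simp add: rb field_simps)
    then have "\<bar>b\<bar> \<le> int q" by linarith
    then have "b \<in> {- int N..int N}" using q by auto
    then show "r \<in> (\<lambda>(b, q). of_int b / of_nat q) ` ({- int N..int N} \<times> {1..N})"
      using q rb by (intro image_eqI[where x = "(b, q)"]) auto
  qed
qed simp

definition Delta :: "real \<Rightarrow> real set \<Rightarrow> (real \<Rightarrow> complex) \<Rightarrow> real \<Rightarrow> complex" where
  "Delta \<epsilon> R \<mm> \<xi> = (\<Sum>r\<in>R. \<mm> (inverse \<epsilon> * torus_rep (\<xi> - r)))"

definition multiplier_op :: "(real \<Rightarrow> complex) \<Rightarrow> (int \<Rightarrow> complex) \<Rightarrow> int \<Rightarrow> complex" where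
  "multiplier_op M f = fourier_Z_inv (\<lambda>\<xi>. M \<xi> * fourier_Z f \<xi>)"

definition lp_op_norm ::
    "real \<Rightarrow> ((int \<Rightarrow> complex) \<Rightarrow> int \<Rightarrow> complex) \<Rightarrow> ennreal" where
  "lp_op_norm p T = (SUP f \<in> {f. lp_norm 2 f < \<infinity> \<and> lp_norm p f \<le> 1}. lp_norm p (T f))"

text \<open>The \<open>k\<close>-th derivative of a complex-valued function of a real variable.\<close>

definition nth_deriv :: "nat \<Rightarrow> (real \<Rightarrow> complex) \<Rightarrow> real \<Rightarrow> complex" where
  "nth_deriv k f = ((\<lambda>g x. vector_derivative g (at x)) ^^ k) f"

definition schwartz :: "(real \<Rightarrow> complex) \<Rightarrow> bool" where
  "schwartz f \<longleftrightarrow>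
     (\<forall>k x. nth_deriv k f differentiable (at x)) \<and>
     (\<forall>j k. bounded (range (\<lambda>x. x ^ j *\<^sub>R nth_deriv k f x)))"

end

theory Submission
  imports Defs "HOL-Computational_Algebra.Primes" "HOL-Real_Asymp.Real_Asymp"
begin

text \<open>
  Take \<open>N + 1 = Q\<close>, a product of \<open>k\<close> distinct primes of size polynomial in \<open>k\<close>, so that Chebyshev's lower bound
  gives \<open>k\<close> of order at least \<open>log N / log log N\<close>. Among the fractions \<open>b / Q\<close> the multiplier is \<open>1\<close> at those
  that reduce to a smaller denominator and \<open>0\<close> at the primitive ones. Hence on \<open>Q\<close>-periodic functions
  the operator is the identity minus the projection to primitive frequencies, and by the Chinese
  remainder theorem this projection is the tensor product over \<open>P | Q\<close> of the projections
  \<open>f \<mapsto> f - mean f\<close> on \<open>\<int>/P\<int>\<close>. For \<open>p \<noteq> 2\<close> the \<open>\<ell>\<^sup>p\<close> norm of each factor exceeds some \<open>1 + \<eta>\<close>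
  with \<open>\<eta>\<close> independent of \<open>P\<close>, so that of the product grows exponentially in \<open>k\<close>. Truncation to long windows
  transfers this from periodic functions to \<open>\<ell>\<^sup>p(\<int>)\<close>.
\<close>

text \<open>Deleting the single denominator Q is the point of \<open>N + 1 = Q\<close>: canonical
  fractions up to Q would contain every \<open>b / Q\<close>, and the multiplier would be 1 on all
  of them. The operator is only a difference, so its norm does not multiply over the primes; the
  triangle inequality bounds the projection by the operator plus the identity, at the cost of a
  constant that the exponential gain absorbs. Each factor of the projection sends a mean-zero step
  plus a constant \<open>c\<close> to the step alone, and \<open>c\<close> is chosen so that adding
  it shrinks the norm. With k of order \<open>ln N / ln (ln N)\<close>, a gain
  \<open>exp (a k)\<close> is a power of N with exponent of order \<open>1 / ln (ln N)\<close>. The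
  widths leave little room: fractions may be only \<open>1 / (Q N)\<close> apart, slightly less than
  \<open>1 / N^2\<close>, but a bump of width \<open>\<epsilon>\<close> reaches only
  \<open>\<epsilon> / 2\<close> from its centre. Smoothness of \<open>\<mm>\<close> enters through
  an absolutely summable convolution kernel, which gives the operator a meaning on periodic
  functions and makes truncation errors small.\<close>

section \<open>Many small primes\<close>

text \<open>This is the recurrence of the Leibniz harmonic triangle: the reciprocal of
  \<open>(k+1) (m+1 choose k+1)\<close> is the difference of the reciprocals of
  \<open>k (m choose k)\<close> and \<open>k (m+1 choose k)\<close>. Multiplied by D, both terms on
  the right are integers by induction.\<close>

lemma mult_binomial_dvd_common_multiple:
  fixes D n k :: nat
  assumes "\<forall>i\<in>{1..n}. i dvd D" "1 \<le> k" "k \<le> n"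
  shows "k * (n choose k) dvd D"
  using assms(2,1,3)
proof (induction k arbitrary: n rule: dec_induct)
  case base
  then show ?case by auto
next
  case (step k)
  obtain m where n: "n = Suc m" using step.prems by (cases n) auto
  have km: "k \<le> m" using step.prems n by simp
  obtain z1 where z1: "D = k * (m choose k) * z1"
    using step.IH[of m] step.prems n km by (auto elim!: dvdE)
  obtain z2 where z2: "D = k * (Suc m choose k) * z2"
    using step.IH[of "Suc m"] step.prems n km by (auto elim!: dvdE)
  define c where "c = int (m choose k)"
  have e1: "int (Suc m choose k) * (int m + 1 - int k) = (int m + 1) * c"
  proof -
    have "(Suc m - k) * (Suc m choose k) = Suc m * (m choose k)"
      using binomial_absorb_comp[of "Suc m" k] by simp
    then have "int (Suc m - k) * int (Suc m choose k) = int (Suc m) * c"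
      unfolding c_def by (metis of_nat_mult)
    then show ?thesis using km by (simp add: of_nat_diff algebra_simps)
  qed
  have e2: "int (Suc k * (Suc m choose Suc k)) = (int m + 1) * c"
    using Suc_times_binomial_eq[of m k] unfolding c_def
    by (metis of_nat_Suc of_nat_mult add.commute mult.commute)
  have d1: "int D = int k * c * int z1" using arg_cong[OF z1, of int] by (simp add: c_def)
  have d2: "int D = int k * int (Suc m choose k) * int z2"
    using arg_cong[OF z2, of int] by (simp del: binomial_Suc_Suc)
  have "int D * (int m + 1 - int k) = int k * (int m + 1) * c * int z2"
    unfolding d2 using e1 by (metis (no_types, opaque_lifting) mult.assoc mult.commute)
  then have "int k * int D = int k * ((int z1 - int z2) * ((int m + 1) * c))"
    using d1 by (simp add: algebra_simps)
  then have "int D = (int z1 - int z2) * ((int m + 1) * c)"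
    using step.hyps by simp
  then have "int (Suc k * (Suc m choose Suc k)) dvd int D"
    unfolding e2 by simp
  then show ?case unfolding n int_dvd_int_iff .
qed

text \<open>The product of the largest prime powers up to \<open>n\<close> plays the role of \<open>lcm(1, \<dots>, n)\<close>.\<close>
lemma primes_power_count_ge_binomial:
  fixes n k :: nat
  assumes "1 \<le> k" "k \<le> n"
  shows "k * (n choose k) \<le> n ^ card {q. prime q \<and> q \<le> n}"
proof -
  let ?P = "{q::nat. prime q \<and> q \<le> n}"
  define a where "a q = (GREATEST j. q ^ j \<le> n)" for q
  define D where "D = (\<Prod>q\<in>?P. q ^ a q)"
  have n1: "1 \<le> n" using assms by simp
  have fin: "finite ?P" by (rule finite_subset[of _ "{..n}"]) auto
  \<comment> \<open>\<open>GREATEST\<close> needs an a priori bound on the exponents, both for its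
    defining property and for its maximality.\<close>
  have bd: "j \<le> n" if "q \<in> ?P" "q ^ j \<le> n" for q j
  proof -
    have "q \<ge> 2" using that(1) by (auto simp: prime_ge_2_nat)
    then have "j < q ^ j" by (intro power_gt_expt) auto
    then show ?thesis using that(2) by simp
  qed
  have a1: "q ^ a q \<le> n" if "q \<in> ?P" for q
    unfolding a_def by (rule GreatestI_nat[of _ 0 n], use n1 in simp, use bd[OF that] in blast)
  have a2: "j \<le> a q" if "q \<in> ?P" "q ^ j \<le> n" for q j
    unfolding a_def using Greatest_le_nat[of "\<lambda>j. q ^ j \<le> n" j n] that(2) bd[OF that(1)] by blast
  have Dpos: "D > 0" unfolding D_def by (rule prod_pos) (auto simp: prime_gt_0_nat)
  have "i dvd D" if i: "i \<in> {1..n}" for i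
  proof (rule multiplicity_le_imp_dvd)
    show "i \<noteq> 0" using i by auto
    fix q :: nat assume q: "prime q"
    show "multiplicity q i \<le> multiplicity q D"
    proof (cases "q \<le> n")
      case True
      have "q ^ multiplicity q i \<le> i"
        using i by (intro dvd_imp_le multiplicity_dvd) auto
      then have "multiplicity q i \<le> a q" using i q True by (intro a2) auto
      moreover have "q ^ a q dvd D"
        unfolding D_def using q True fin by (intro dvd_prodI) auto
      ultimately have d: "q ^ multiplicity q i dvd D"
        by (rule dvd_trans[OF le_imp_power_dvd])
      show ?thesis
        by (rule multiplicity_geI[OF _ _ d]) (use Dpos q in auto)
    next
      case False
      have "\<not> q dvd i" using False i by (auto dest: dvd_imp_le)
      then show ?thesis by (simp add: not_dvd_imp_multiplicity_0)
    qed
  qed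
  then have "k * (n choose k) dvd D"
    using assms by (intro mult_binomial_dvd_common_multiple) auto
  then have "k * (n choose k) \<le> D" using Dpos by (rule dvd_imp_le)
  also have "D \<le> (\<Prod>q\<in>?P. n)" unfolding D_def by (intro prod_mono) (simp add: a1)
  finally show ?thesis by simp
qed

text \<open>Comparing \<open>4^n / 2 <= n (2n choose n)\<close> with \<open>(2n)^k\<close>, where k
  counts the primes up to 2n, gives k at least of order \<open>n / ln n\<close>. The much weaker
  square root suffices, since only the logarithms of the primes matter later; the summand
  \<open>P0\<close> pays for discarding small primes.\<close>

lemma prime_count_ge_sqrt:
  fixes P0 :: real
  shows "\<forall>\<^sub>F n::nat in sequentially.
    P0 + sqrt (2 * real n) \<le> real (card {q::nat. prime q \<and> q \<le> 2 * n})"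
proof -
  have ev: "\<forall>\<^sub>F n::nat in sequentially.
     (P0 + sqrt (2 * real n)) * ln (2 * real n) \<le> real n * ln 4 - ln 2"
    by real_asymp
  show ?thesis using ev eventually_ge_at_top[of 1]
  proof eventually_elim
    case (elim n)
    let ?k = "card {q::nat. prime q \<and> q \<le> 2 * n}"
    have "4 ^ n / (2 * real n) \<le> real ((2 * n) choose n)"
      using elim by (intro central_binomial_lower_bound) auto
    then have "4 ^ n / 2 \<le> real (n * ((2 * n) choose n))"
      using elim by (simp add: field_simps)
    also have "\<dots> \<le> real ((2 * n) ^ ?k)"
      using elim by (intro of_nat_mono primes_power_count_ge_binomial) auto
    finally have "4 ^ n / 2 \<le> (2 * real n) ^ ?k" by simp
    then have "ln (4 ^ n / 2) \<le> ln ((2 * real n) ^ ?k)"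
      using elim by (intro ln_mono) auto
    moreover have "ln (4 ^ n / 2 :: real) = real n * ln 4 - ln 2"
      by (simp add: ln_div ln_realpow)
    ultimately have "real n * ln 4 - ln 2 \<le> real ?k * ln (2 * real n)"
      unfolding ln_realpow by linarith
    then have "(P0 + sqrt (2 * real n)) * ln (2 * real n) \<le> real ?k * ln (2 * real n)"
      using elim by linarith
    moreover have "ln (2 * real n) > 0" using elim by (intro ln_gt_zero) auto
    ultimately show ?case by simp
  qed
qed

text \<open>All primes in \<open>(P0, 2n]\<close> are taken. If there are k of them, the square root
  bound gives \<open>2n <= k^2\<close>, so each prime is at most \<open>k^2\<close> and the product
  at most \<open>k^(2k)\<close>.\<close>

lemma many_primes_small_product:
  fixes P0 K :: nat
  obtains I :: "nat set" where "finite I" "\<And>q. q \<in> I \<Longrightarrow> prime q \<and> P0 < q" "K \<le> card I"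
    "ln (real (\<Prod>I)) \<le> 2 * real (card I) * ln (real (card I))"
proof -
  have ev: "\<forall>\<^sub>F n::nat in sequentially. real K + 1 \<le> sqrt (2 * real n)" by real_asymp
  obtain n :: nat where n: "real P0 + sqrt (2 * real n) \<le> real (card {q::nat. prime q \<and> q \<le> 2 * n})"
    "real K + 1 \<le> sqrt (2 * real n)" "n \<ge> 1"
    using eventually_happens[OF eventually_conj[OF prime_count_ge_sqrt[of "real P0"]
      eventually_conj[OF ev eventually_ge_at_top[of 1]]]] by auto
  define I where "I = {q::nat. prime q \<and> P0 < q \<and> q \<le> 2 * n}"
  have fin: "finite I" unfolding I_def by (rule finite_subset[of _ "{..2*n}"]) auto
  have "card {q::nat. prime q \<and> q \<le> 2 * n} \<le> card (I \<union> {1..P0})"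
    by (rule card_mono) (use fin in \<open>auto simp: I_def dest: prime_gt_0_nat\<close>)
  also have "\<dots> \<le> card I + P0" using card_Un_le[of I "{1..P0}"] by simp
  finally have sq: "sqrt (2 * real n) \<le> real (card I)" using n(1) by linarith
  then have k1: "real (card I) \<ge> real K + 1" using n(2) by linarith
  have le: "2 * real n \<le> (real (card I))\<^sup>2"
    using sq by (simp add: sqrt_le_D)
  have pos: "real (\<Prod>I) > 0"
    using prod_pos[of I "\<lambda>q. q"] unfolding of_nat_0_less_iff by (auto simp: I_def dest: prime_gt_0_nat)
  have "(\<Prod>I) \<le> (\<Prod>q\<in>I. 2 * n)" by (rule prod_mono) (auto simp: I_def)
  then have "\<Prod>I \<le> (2 * n) ^ card I" by simp
  then have "real (\<Prod>I) \<le> (2 * real n) ^ card I"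
    by (metis of_nat_le_iff of_nat_mult of_nat_numeral of_nat_power)
  then have "ln (real (\<Prod>I)) \<le> ln ((2 * real n) ^ card I)"
    using pos n(3) by (intro ln_mono) auto
  also have "\<dots> = real (card I) * ln (2 * real n)" by (rule ln_realpow)
  also have "\<dots> \<le> real (card I) * ln ((real (card I))\<^sup>2)"
    using le n(3) by (intro mult_left_mono ln_mono) auto
  also have "\<dots> = 2 * real (card I) * ln (real (card I))" using k1 by (simp add: ln_realpow)
  finally show ?thesis using fin k1 by (intro that[of I]) (auto simp: I_def)
qed

section \<open>Subtracting the mean on a two-valued function\<close>

text \<open>The left side has slope \<open>d\<close> at \<open>c = 0\<close>, a nonzero multiple of
  \<open>(2/3) powr (p-2) - (1/3) powr (p-2)\<close>, which vanishes only for \<open>p = 2\<close>;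
  so a small shift of the right sign helps. The uneven density 1/3 matters: at density 1/2 the slope
  is 0 for every p by symmetry.\<close>

lemma two_point_shift_gain:
  fixes p :: real
  assumes "1 < p" "p \<noteq> 2"
  obtains c where "(1/3) * \<bar>2/3 + c\<bar> powr p + (2/3) * \<bar>c - 1/3\<bar> powr p
     < (1/3) * (2/3) powr p + (2/3) * (1/3) powr p"
proof -
  define h where "h c = (1/3) * (2/3 + c) powr p + (2/3) * (1/3 - c) powr p" for c :: real
  define d where "d = p * (2/9) * ((2/3) powr (p-2) - (1/3) powr (p-2))"
  have d': "(1/3) * (p * (2/3) powr (p-1)) - (2/3) * (p * (1/3) powr (p-1)) = d"
  proof -
    have "(2/3::real) powr (p-1) = (2/3) powr (p-2) * (2/3)"
      using powr_add[of "2/3::real" "p-2" 1] by simp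
    moreover have "(1/3::real) powr (p-1) = (1/3) powr (p-2) * (1/3)"
      using powr_add[of "1/3::real" "p-2" 1] by simp
    ultimately show ?thesis unfolding d_def by (simp add: algebra_simps)
  qed
  have D: "(h has_real_derivative d) (at 0)"
    unfolding h_def d'[symmetric]
    by (auto intro!: derivative_eq_intros simp: powr_diff field_simps)
  have "d \<noteq> 0"
  proof -
    have "(2/3::real) powr (p-2) \<noteq> (1/3) powr (p-2)"
    proof (cases "p < 2")
      case True
      then show ?thesis using powr_less_mono2_neg[of "p-2" "1/3" "2/3::real"] by simp
    next
      case False
      then show ?thesis using assms powr_less_mono2[of "p-2" "1/3" "2/3::real"] by simp
    qed
    then show ?thesis using assms by (simp add: d_def)
  qed
  \<comment> \<open>For \<open>c\<close> within 1/3 of 0 both bases in \<open>h\<close> are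
    positive, so \<open>h\<close> agrees with the expression with absolute values.\<close>
  have "\<exists>c. \<bar>c\<bar> < 1/3 \<and> h c < h 0"
  proof (cases "d < 0")
    case True
    from DERIV_neg_dec_right[OF D True] obtain e where
      e: "e > 0" "\<And>t. 0 < t \<Longrightarrow> t < e \<Longrightarrow> h (0 + t) < h 0" by blast
    show ?thesis using e(1) e(2)[of "min e (1/3) / 2"]
      by (intro exI[of _ "min e (1/3) / 2"]) (auto simp: min_def)
  next
    case False
    then have "d > 0" using \<open>d \<noteq> 0\<close> by simp
    from DERIV_pos_inc_left[OF D this] obtain e where
      e: "e > 0" "\<And>t. 0 < t \<Longrightarrow> t < e \<Longrightarrow> h (0 - t) < h 0" by blast
    show ?thesis using e(1) e(2)[of "min e (1/3) / 2"]
      by (intro exI[of _ "- min e (1/3) / 2"]) (auto simp: min_def)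
  qed
  then obtain c where c: "\<bar>c\<bar> < 1/3" "h c < h 0" by blast
  have "\<bar>2/3 + c\<bar> = 2/3 + c" "\<bar>c - 1/3\<bar> = 1/3 - c" using c(1) by linarith+
  then show ?thesis using c(2) by (intro that[of c]) (simp add: h_def)
qed

text \<open>A function taking the value \<open>1 - \<alpha>\<close> on a set of density \<open>\<alpha> = a / P\<close> and \<open>- \<alpha>\<close> off
  it has mean zero; adding the constant \<open>c\<close> strictly decreases its \<open>\<ell>\<^sup>p\<close> norm.\<close>
lemma uniform_shift_gain:
  fixes p :: real
  assumes "1 < p" "p \<noteq> 2"
  obtains c \<eta> :: real and P0 :: nat where "0 < \<eta>" "\<eta> < 1"
    "\<And>P. P > P0 \<Longrightarrow> (1 + \<eta>) *
       (real (P div 3) * \<bar>1 - real (P div 3) / real P + c\<bar> powr p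
         + (real P - real (P div 3)) * \<bar>c - real (P div 3) / real P\<bar> powr p)
       \<le> real (P div 3) * (1 - real (P div 3) / real P) powr p
         + (real P - real (P div 3)) * (real (P div 3) / real P) powr p"
proof -
  obtain c where c: "(1/3) * \<bar>2/3 + c\<bar> powr p + (2/3) * \<bar>c - 1/3\<bar> powr p
     < (1/3) * (2/3) powr p + (2/3) * (1/3) powr p"
    using two_point_shift_gain[OF assms] by blast
  \<comment> \<open>\<open>H t \<alpha>\<close> is the mean over a period of the p-th power of the
    step of density \<open>\<alpha>\<close> shifted by t; P times it is the sum in the
    statement.\<close>
  define H where "H t \<alpha> = \<alpha> * \<bar>1 - \<alpha> + t\<bar> powr p + (1 - \<alpha>) * \<bar>t - \<alpha>\<bar> powr p" for t \<alpha> :: real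
  have c': "H c (1/3) < H 0 (1/3)" using c by (simp add: H_def)
  have "\<exists>\<eta>>0. \<eta> < 1 \<and> (1 + \<eta>) * H c (1/3) < H 0 (1/3)"
  proof -
    have "((\<lambda>\<eta>. (1 + \<eta>) * H c (1/3)) \<longlongrightarrow> (1 + 0) * H c (1/3)) (at_right 0)"
      by (intro tendsto_intros)
    then have "\<forall>\<^sub>F \<eta> in at_right 0. (1 + \<eta>) * H c (1/3) < H 0 (1/3)"
      using c' by (intro order_tendstoD(2)) auto
    moreover have "\<forall>\<^sub>F \<eta>::real in at_right 0. \<eta> \<in> {0<..<1}"
      by (rule eventually_at_right_real) simp
    ultimately have "\<forall>\<^sub>F \<eta> in at_right 0. (1 + \<eta>) * H c (1/3) < H 0 (1/3) \<and> \<eta> \<in> {0<..<1}"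
      by eventually_elim auto
    from eventually_happens[OF this] show ?thesis by auto
  qed
  then obtain \<eta> where \<eta>: "\<eta> > 0" "\<eta> < 1" "(1 + \<eta>) * H c (1/3) < H 0 (1/3)" by blast
  define \<alpha> where "\<alpha> P = real (P div 3) / real P" for P :: nat
  have lim: "\<alpha> \<longlonglongrightarrow> 1/3"
  proof (rule tendsto_sandwich)
    show "\<forall>\<^sub>F P in sequentially. 1/3 - 1 / real P \<le> \<alpha> P"
      using eventually_gt_at_top[of 0]
    proof eventually_elim
      case (elim P)
      have "real P / 3 - 1 \<le> real (P div 3)" by linarith
      then have "(real P / 3 - 1) / real P \<le> \<alpha> P"
        unfolding \<alpha>_def by (intro divide_right_mono) auto
      then show ?case using elim by (simp add: diff_divide_distrib)
    qed
    show "\<forall>\<^sub>F P in sequentially. \<alpha> P \<le> 1/3"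
      using eventually_gt_at_top[of 0]
    proof eventually_elim
      case (elim P)
      have "real (P div 3) \<le> real P / 3" by linarith
      then show ?case using elim by (simp add: \<alpha>_def field_simps)
    qed
  qed real_asymp+
  have HH: "(\<lambda>P. H t (\<alpha> P)) \<longlonglongrightarrow> H t (1/3)" for t
    unfolding H_def using assms by (intro tendsto_intros lim tendsto_powr') auto
  \<comment> \<open>The density \<open>\<alpha> P\<close> tends to 1/3 and \<open>H\<close> is
    continuous in the density there, so the strict inequality at 1/3 persists for all large P with
    one and the same \<open>\<eta>\<close>.\<close>
  have "(\<lambda>P. H 0 (\<alpha> P) - (1 + \<eta>) * H c (\<alpha> P)) \<longlonglongrightarrow> H 0 (1/3) - (1 + \<eta>) * H c (1/3)"
    by (intro tendsto_intros HH)
  then have "\<forall>\<^sub>F P in sequentially. H 0 (\<alpha> P) - (1 + \<eta>) * H c (\<alpha> P) > 0"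
    using \<eta>(3) by (intro order_tendstoD(1)) auto
  then obtain P0 where P0: "\<And>P. P \<ge> P0 \<Longrightarrow> (1 + \<eta>) * H c (\<alpha> P) \<le> H 0 (\<alpha> P)"
    unfolding eventually_sequentially by fastforce
  have *: "real (P div 3) * \<bar>1 - \<alpha> P + t\<bar> powr p + (real P - real (P div 3)) * \<bar>t - \<alpha> P\<bar> powr p
      = real P * H t (\<alpha> P)" if "P > 0" for t P
    using that by (simp add: H_def \<alpha>_def algebra_simps)
  show ?thesis
  proof (rule that[of \<eta> P0 c])
    fix P assume P: "P > P0"
    have a: "\<alpha> P \<ge> 0" "\<alpha> P \<le> 1" using P by (auto simp: \<alpha>_def)
    have "real P * ((1 + \<eta>) * H c (\<alpha> P)) \<le> real P * H 0 (\<alpha> P)"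
      using P0[of P] P by (intro mult_left_mono) auto
    then show "(1 + \<eta>) * (real (P div 3) * \<bar>1 - real (P div 3) / real P + c\<bar> powr p
         + (real P - real (P div 3)) * \<bar>c - real (P div 3) / real P\<bar> powr p)
       \<le> real (P div 3) * (1 - real (P div 3) / real P) powr p
         + (real P - real (P div 3)) * (real (P div 3) / real P) powr p"
      using *[of P c] *[of P 0] P a unfolding \<alpha>_def[symmetric] by (simp add: algebra_simps)
  qed (use \<eta> in auto)
qed

section \<open>Trigonometric polynomials and products of step functions\<close>

lemma e_char_cis: "e_char x = cis (2 * pi * x)"
  by (simp add: e_char_def cis_conv_exp mult_ac)

lemma e_char_add: "e_char (x + y) = e_char x * e_char y"
  by (simp add: e_char_cis cis_mult algebra_simps)

lemma e_char_0 [simp]: "e_char 0 = 1"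
  by (simp add: e_char_cis)

lemma cmod_e_char [simp]: "cmod (e_char x) = 1"
  by (simp add: e_char_cis)

lemma e_char_of_int [simp]: "e_char (of_int n) = 1"
  using cis_multiple_2pi[of "of_int n"] by (simp add: e_char_cis)

lemma e_char_eq_1_iff: "e_char x = 1 \<longleftrightarrow> x \<in> \<int>"
proof
  assume "e_char x = 1"
  then obtain n :: int where "2 * pi * x = of_int (2 * n) * pi"
    unfolding e_char_def exp_eq_1 by auto
  then have "x = of_int n" by simp
  then show "x \<in> \<int>" by simp
qed (auto elim!: Ints_cases)

lemma e_char_power: "e_char x ^ n = e_char (real n * x)"
  unfolding e_char_cis Complex.DeMoivre by (simp add: mult_ac)

lemma continuous_on_e_char [continuous_intros]:
  "continuous_on S f \<Longrightarrow> continuous_on S (\<lambda>x. e_char (f x))"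
  unfolding e_char_def by (intro continuous_intros)

lemma e_char_borel_measurable [measurable]: "e_char \<in> borel_measurable borel"
  by (intro borel_measurable_continuous_onI continuous_intros)

lemma sum_e_char_roots:
  fixes n :: int
  assumes "q > 0"
  shows "(\<Sum>b<q. e_char (real b * (of_int n / real q))) = (if int q dvd n then of_nat q else 0)"
proof (cases "int q dvd n")
  case True
  then obtain m where "n = int q * m" by blast
  then have "e_char (real b * (of_int n / real q)) = 1" for b
    using assms e_char_of_int[of "int b * m"] by simp
  then show ?thesis using True by simp
next
  case False
  let ?z = "e_char (of_int n / real q)"
  have "?z \<noteq> 1"
  proof
    assume "?z = 1"
    then obtain m :: int where "of_int n / real q = of_int m"
      unfolding e_char_eq_1_iff by (auto elim: Ints_cases)
    then have "real_of_int n = of_int (m * int q)" using assms by (simp add: field_simps)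
    then have "n = m * int q" by (simp only: of_int_eq_iff)
    then show False using False by simp
  qed
  moreover have "?z ^ q = 1"
    using assms by (simp add: e_char_power)
  ultimately have "(\<Sum>b<q. ?z ^ b) = 0"
    by (simp add: sum_gp_strict)
  then show ?thesis using False by (simp add: e_char_power)
qed

text \<open>Only the set of admissible frequencies is recorded, not the coefficients. The inductive
  form lets closure under products and the action of a convolution be proved by rule
  induction.\<close>

inductive_set trig_poly :: "real set \<Rightarrow> (int \<Rightarrow> complex) set" for \<Theta> where
  zero: "(\<lambda>_. 0) \<in> trig_poly \<Theta>"
| add_term: "\<theta> \<in> \<Theta> \<Longrightarrow> f \<in> trig_poly \<Theta> \<Longrightarrow> (\<lambda>x. c * e_char (of_int x * \<theta>) + f x) \<in> trig_poly \<Theta>"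

lemma trig_poly_single: "\<theta> \<in> \<Theta> \<Longrightarrow> (\<lambda>x. c * e_char (of_int x * \<theta>)) \<in> trig_poly \<Theta>"
  using trig_poly.add_term[OF _ trig_poly.zero, of \<theta> \<Theta> c] by simp

lemma trig_poly_add: "f \<in> trig_poly \<Theta> \<Longrightarrow> g \<in> trig_poly \<Theta> \<Longrightarrow> (\<lambda>x. f x + g x) \<in> trig_poly \<Theta>"
  by (induction rule: trig_poly.induct) (auto simp: add.assoc intro: trig_poly.intros)

lemma trig_poly_sum:
  assumes "\<And>i. i \<in> I \<Longrightarrow> f i \<in> trig_poly \<Theta>"
  shows "(\<lambda>x. \<Sum>i\<in>I. f i x) \<in> trig_poly \<Theta>"
  using assms
  by (induction I rule: infinite_finite_induct) (auto intro: trig_poly.zero trig_poly_add)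

lemma trig_poly_scale_shift:
  assumes "f \<in> trig_poly A" "\<And>\<alpha>. \<alpha> \<in> A \<Longrightarrow> \<alpha> + \<beta> \<in> \<Theta>"
  shows "(\<lambda>x. c * e_char (of_int x * \<beta>) * f x) \<in> trig_poly \<Theta>"
  using assms(1)
proof induction
  case zero
  then show ?case by (simp add: trig_poly.zero)
next
  case (add_term \<theta> f d)
  have "(\<lambda>x. (c * d) * e_char (of_int x * (\<theta> + \<beta>)) + c * e_char (of_int x * \<beta>) * f x)
      \<in> trig_poly \<Theta>"
    using add_term assms(2) by (intro trig_poly.add_term) auto
  then show ?case by (simp add: algebra_simps e_char_add)
qed

lemma trig_poly_scale: "f \<in> trig_poly \<Theta> \<Longrightarrow> (\<lambda>x. c * f x) \<in> trig_poly \<Theta>"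
  using trig_poly_scale_shift[of f \<Theta> 0 \<Theta> c] by simp

lemma trig_poly_mult:
  assumes "f \<in> trig_poly A" "g \<in> trig_poly B" "\<And>\<alpha> \<beta>. \<alpha> \<in> A \<Longrightarrow> \<beta> \<in> B \<Longrightarrow> \<alpha> + \<beta> \<in> \<Theta>"
  shows "(\<lambda>x. f x * g x) \<in> trig_poly \<Theta>"
  using assms(1)
proof induction
  case zero
  then show ?case by (simp add: trig_poly.zero)
next
  case (add_term \<theta> f c)
  have "\<beta> + \<theta> \<in> \<Theta>" if "\<beta> \<in> B" for \<beta>
    using assms(3)[OF add_term(1) that] by (simp add: add.commute)
  then have "(\<lambda>x. c * e_char (of_int x * \<theta>) * g x + f x * g x) \<in> trig_poly \<Theta>"
    using add_term assms(2) by (intro trig_poly_add trig_poly_scale_shift[where A = B])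
  then show ?case by (simp add: algebra_simps)
qed

lemma trig_poly_mono: "f \<in> trig_poly A \<Longrightarrow> A \<subseteq> B \<Longrightarrow> f \<in> trig_poly B"
  by (induction rule: trig_poly.induct) (auto intro: trig_poly.intros)

text \<open>Numerators range over all integers, so sums of frequencies need no reduction modulo 1.
  For \<open>q = 1\<close> every integer is primitive, which starts the induction over primes at the
  empty product.\<close>

definition primitive_freqs :: "nat \<Rightarrow> real set" where
  "primitive_freqs q = {of_int b / real q | b :: int. coprime b (int q)}"

definition imprimitive_freqs :: "nat \<Rightarrow> real set" where
  "imprimitive_freqs q = {of_int b / real q | b :: int. \<not> coprime b (int q)}"

text \<open>The indicator of the first third of the residues modulo P, rounded down, minus its
  mean.\<close>

definition mean_zero_step :: "nat \<Rightarrow> int \<Rightarrow> real" where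
  "mean_zero_step P x = (if x mod int P < int (P div 3) then 1 else 0) - real (P div 3) / real P"

text \<open>In the finite Fourier expansion modulo P the zero frequency carries the mean, which is
  0, and since P is prime all the other numerators \<open>1, ..., P - 1\<close> are coprime to
  P.\<close>

lemma mean_zero_step_trig_poly:
  assumes "prime P"
  shows "(\<lambda>x. complex_of_real (mean_zero_step P x)) \<in> trig_poly (primitive_freqs P)"
proof -
  have P0: "P > 0" using assms by (simp add: prime_gt_0_nat)
  let ?a = "P div 3"
  define h where "h x = (\<Sum>y<?a. \<Sum>b\<in>{1..<P}. (e_char (- (real b * real y / real P)) / of_nat P)
      * e_char (of_int x * (of_int (int b) / real P)))" for x :: int
  have "h \<in> trig_poly (primitive_freqs P)"
  proof -
    have "of_int (int b) / real P \<in> primitive_freqs P" if "b \<in> {1..<P}" for b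
    proof -
      have "coprime b P" using assms that
        by (metis atLeastLessThan_iff coprime_commute nat_dvd_not_less not_one_le_zero
            prime_imp_coprime_nat zero_less_iff_neq_zero)
      then show ?thesis unfolding primitive_freqs_def by (auto intro!: exI[of _ "int b"])
    qed
    then show ?thesis unfolding h_def by (intro trig_poly_sum trig_poly_single) auto
  qed
  moreover have "h x = complex_of_real (mean_zero_step P x)" for x
  proof -
    \<comment> \<open>Over all b the sum detects the residue class of y; leaving out
      \<open>b = 0\<close> subtracts its mean \<open>1 / P\<close>.\<close>
    have inner: "(\<Sum>b\<in>{1..<P}. (e_char (- (real b * real y / real P)) / of_nat P)
      * e_char (of_int x * (of_int (int b) / real P)))
      = (if int P dvd x - int y then 1 else 0) - 1 / of_nat P" for y
    proof -
      have "(\<Sum>b\<in>{1..<P}. (e_char (- (real b * real y / real P)) / of_nat P)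
          * e_char (of_int x * (of_int (int b) / real P)))
        = (\<Sum>b\<in>{1..<P}. e_char (real b * (of_int (x - int y) / real P))) / of_nat P"
        unfolding sum_divide_distrib
        by (intro sum.cong refl) (simp add: diff_divide_distrib right_diff_distrib
              flip: e_char_add, simp add: algebra_simps)
      also have "(\<Sum>b\<in>{1..<P}. e_char (real b * (of_int (x - int y) / real P)))
        = (\<Sum>b<P. e_char (real b * (of_int (x - int y) / real P))) - 1"
      proof -
        have "{..<P} = insert 0 {1..<P}" using P0 by auto
        then show ?thesis by (simp only: sum.insert finite_atLeastLessThan) simp
      qed
      finally show ?thesis unfolding sum_e_char_roots[OF P0] using P0
        by (simp add: diff_divide_distrib)
    qed
    have "(\<Sum>y<?a. if int P dvd x - int y then 1 else 0 :: complex)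
        = (if x mod int P < int ?a then 1 else 0)"
    proof -
      have "int P dvd x - int y \<longleftrightarrow> y = nat (x mod int P)" if "y < ?a" for y
      proof -
        have "y < P" using that by linarith
        then have "int y mod int P = int y" by simp
        then show ?thesis using P0 by (metis mod_eq_dvd_iff nat_int nat_mod_distrib
          Euclidean_Rings.pos_mod_sign of_nat_0_less_iff int_nat_eq)
      qed
      then have "(\<Sum>y<?a. if int P dvd x - int y then 1 else 0 :: complex)
        = (\<Sum>y<?a. if y = nat (x mod int P) then 1 else 0)"
        by (intro sum.cong refl) auto
      also have "\<dots> = (if nat (x mod int P) < ?a then 1 else 0)" by (simp add: sum.delta)
      finally show ?thesis using P0 by (simp add: nat_less_iff)
    qed
    then show ?thesis unfolding h_def inner by (simp add: sum_subtractf mean_zero_step_def)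
  qed
  ultimately show ?thesis by (metis (no_types, lifting) ext)
qed

text \<open>Expanding the product of the \<open>mean_zero_step P x + c\<close>, the only term with
  every prime of I in its denominators is the product of the steps. So that product is the primitive
  part of the whole, and the difference collects the imprimitive frequencies.\<close>

lemma step_product_trig_poly:
  fixes c :: real
  assumes "finite I" "\<And>P. P \<in> I \<Longrightarrow> prime P"
  shows "(\<lambda>x. complex_of_real (\<Prod>P\<in>I. mean_zero_step P x)) \<in> trig_poly (primitive_freqs (\<Prod>I)) \<and>
    (\<lambda>x. complex_of_real ((\<Prod>P\<in>I. mean_zero_step P x + c) - (\<Prod>P\<in>I. mean_zero_step P x)))
      \<in> trig_poly (imprimitive_freqs (\<Prod>I))"
  using assms
proof (induction I rule: finite_induct)
  case empty
  have "0 \<in> primitive_freqs 1" unfolding primitive_freqs_def by (auto intro: exI[of _ 0])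
  from trig_poly_single[OF this, of 1] show ?case by (simp add: trig_poly.zero)
next
  case (insert P I)
  let ?Q = "\<Prod>I"
  let ?G = "\<lambda>x. \<Prod>P\<in>I. mean_zero_step P x"
  let ?F = "\<lambda>x. \<Prod>P\<in>I. mean_zero_step P x + c"
  have P: "prime P" using insert by simp
  have P0: "P > 0" using P by (simp add: prime_gt_0_nat)
  have Q0: "?Q > 0" using insert.prems by (auto intro!: prod_pos simp: prime_gt_0_nat)
  have cop: "coprime P ?Q"
    using insert by (intro prod_coprime_right) (auto intro!: primes_coprime)
  have copi: "coprime (int P) (int ?Q)" using cop by (simp only: coprime_int_iff)
  note g = mean_zero_step_trig_poly[OF P]
  have IH: "(\<lambda>x. complex_of_real (?G x)) \<in> trig_poly (primitive_freqs ?Q)"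
    "(\<lambda>x. complex_of_real (?F x - ?G x)) \<in> trig_poly (imprimitive_freqs ?Q)"
    using insert by auto
  have addfrac: "of_int b / real P + of_int b' / real ?Q
      = of_int (b * int ?Q + b' * int P) / real (P * ?Q)" for b b'
    using P0 Q0 by (simp add: field_simps del: of_nat_prod)
  have 1: "\<alpha> + \<beta> \<in> primitive_freqs (P * ?Q)"
    if "\<alpha> \<in> primitive_freqs P" "\<beta> \<in> primitive_freqs ?Q" for \<alpha> \<beta>
  proof -
    obtain b b' where b: "\<alpha> = of_int b / real P" "coprime b (int P)"
      "\<beta> = of_int b' / real ?Q" "coprime b' (int ?Q)"
      using \<open>\<alpha> \<in> _\<close> \<open>\<beta> \<in> _\<close> unfolding primitive_freqs_def by blast
    have "gcd (b * int ?Q + b' * int P) (int P) = gcd (b * int ?Q) (int P)"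
      by (metis gcd.commute gcd_add_mult add.commute)
    then have c1: "coprime (b * int ?Q + b' * int P) (int P)"
      using b(2) copi by (simp add: coprime_iff_gcd_eq_1 [symmetric] coprime_commute del: of_nat_prod)
    have "gcd (b * int ?Q + b' * int P) (int ?Q) = gcd (b' * int P) (int ?Q)"
      by (metis gcd.commute gcd_add_mult)
    then have c2: "coprime (b * int ?Q + b' * int P) (int ?Q)"
      using b(4) copi by (simp add: coprime_iff_gcd_eq_1 [symmetric] coprime_commute del: of_nat_prod)
    have "coprime (b * int ?Q + b' * int P) (int (P * ?Q))"
      using c1 c2 by (simp del: of_nat_prod)
    then show ?thesis unfolding primitive_freqs_def b(1) b(3) addfrac by blast
  qed
  have 2: "of_int b / real P + \<beta> \<in> imprimitive_freqs (P * ?Q)"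
    if \<beta>: "\<beta> \<in> imprimitive_freqs ?Q" for b \<beta>
  proof -
    obtain b' where b: "\<beta> = of_int b' / real ?Q" "\<not> coprime b' (int ?Q)"
      using \<beta> unfolding imprimitive_freqs_def by blast
    then obtain d where d: "d dvd b'" "d dvd int ?Q" "\<not> is_unit d"
      by (auto elim: not_coprimeE)
    have "d dvd b * int ?Q + b' * int P" "d dvd int (P * ?Q)" using d(1,2)
      by (simp_all del: of_nat_prod)
    then have "\<not> coprime (b * int ?Q + b' * int P) (int (P * ?Q))"
      using d(3) not_coprimeI by blast
    then show ?thesis unfolding imprimitive_freqs_def b(1) addfrac by blast
  qed
  \<comment> \<open>Rewritten over the denominator \<open>P * ?Q\<close>, the fraction
    \<open>b' / ?Q\<close> has numerator \<open>b' * P\<close>, which shares the factor P.\<close>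
  have 3: "primitive_freqs ?Q \<subseteq> imprimitive_freqs (P * ?Q)"
  proof
    fix \<beta> assume "\<beta> \<in> primitive_freqs ?Q"
    then obtain b' where b: "\<beta> = of_int b' / real ?Q" unfolding primitive_freqs_def by auto
    have "int P dvd 0 * int ?Q + b' * int P" "int P dvd int (P * ?Q)"
      by (simp_all del: of_nat_prod)
    moreover have "\<not> is_unit (int P)" using prime_gt_1_nat[OF P] by simp
    ultimately have "\<not> coprime (0 * int ?Q + b' * int P) (int (P * ?Q))"
      using not_coprimeI by blast
    then have "of_int 0 / real P + \<beta> \<in> imprimitive_freqs (P * ?Q)"
      unfolding imprimitive_freqs_def b addfrac by blast
    then show "\<beta> \<in> imprimitive_freqs (P * ?Q)" by simp
  qed
  have gc: "(\<lambda>x. complex_of_real (mean_zero_step P x) + complex_of_real c)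
      \<in> trig_poly (range (\<lambda>b::int. of_int b / real P))"
  proof (rule trig_poly_add)
    show "(\<lambda>x. complex_of_real (mean_zero_step P x)) \<in> trig_poly (range (\<lambda>b::int. of_int b / real P))"
      by (rule trig_poly_mono[OF g]) (auto simp: primitive_freqs_def)
    have "0 \<in> range (\<lambda>b::int. of_int b / real P)" by (auto intro: image_eqI[of _ _ 0])
    from trig_poly_single[OF this, of "complex_of_real c"]
    show "(\<lambda>x. complex_of_real c) \<in> trig_poly (range (\<lambda>b::int. of_int b / real P))" by simp
  qed
  have "(\<lambda>x. complex_of_real (mean_zero_step P x) * complex_of_real (?G x))
      \<in> trig_poly (primitive_freqs (P * ?Q))"
    by (rule trig_poly_mult[OF g IH(1)]) (rule 1)
  \<comment> \<open>With g the step at P, \<open>(g + c) F - g G = (g + c) (F - G) + c G\<close>;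
    the first term is imprimitive by \<open>2\<close>, the second by \<open>3\<close>.\<close>
  moreover have "(\<lambda>x. (complex_of_real (mean_zero_step P x) + complex_of_real c) * complex_of_real (?F x - ?G x)
      + complex_of_real c * complex_of_real (?G x)) \<in> trig_poly (imprimitive_freqs (P * ?Q))"
    by (intro trig_poly_add trig_poly_mult[OF gc IH(2)] trig_poly_scale trig_poly_mono[OF IH(1) 3])
      (auto intro: 2)
  ultimately show ?case using insert.hyps by (simp add: algebra_simps)
qed

section \<open>Sums over a full period by the Chinese remainder theorem\<close>

lemma sum_mult_coprime_periods:
  fixes A B :: "int \<Rightarrow> real" and P Q :: nat
  assumes "coprime P Q" "P > 0" "Q > 0"
    and A: "\<And>x. A (x mod int P) = A x" and B: "\<And>x. B (x mod int Q) = B x"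
  shows "(\<Sum>x\<in>{0..<int (P * Q)}. A x * B x) = (\<Sum>x\<in>{0..<int P}. A x) * (\<Sum>x\<in>{0..<int Q}. B x)"
proof -
  let ?f = "\<lambda>x. (x mod int P, x mod int Q)"
  let ?X = "{0..<int (P * Q)}" and ?Y = "{0..<int P} \<times> {0..<int Q}"
  have inj: "inj_on ?f ?X"
  proof
    fix x y assume xy: "x \<in> ?X" "y \<in> ?X" "?f x = ?f y"
    then have "int P dvd x - y" "int Q dvd x - y" by (auto simp: mod_eq_dvd_iff)
    then have "int P * int Q dvd x - y"
      using assms(1) by (intro divides_mult) (auto simp: coprime_int_iff)
    moreover have "\<bar>x - y\<bar> < int P * int Q" using xy(1,2) by auto
    ultimately show "x = y" using dvd_imp_le_int[of "x - y" "int P * int Q"] by auto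
  qed
  \<comment> \<open>Surjectivity comes from injectivity by counting, without constructing an
    inverse.\<close>
  have "?f ` ?X \<subseteq> ?Y" using assms by auto
  moreover have "card (?f ` ?X) = card ?Y"
    using card_image[OF inj] by (simp add: nat_mult_distrib)
  ultimately have "?f ` ?X = ?Y" by (intro card_subset_eq) auto
  then have "bij_betw ?f ?X ?Y" using inj by (simp add: bij_betw_def)
  then have "(\<Sum>x\<in>?X. A (fst (?f x)) * B (snd (?f x))) = (\<Sum>z\<in>?Y. A (fst z) * B (snd z))"
    by (rule sum.reindex_bij_betw)
  then show ?thesis using A B by (simp add: sum_product sum.cartesian_product case_prod_beta)
qed

lemma sum_prod_prime_periods:
  fixes \<phi> :: "nat \<Rightarrow> int \<Rightarrow> real"
  assumes "finite I" "\<And>P. P \<in> I \<Longrightarrow> prime P" "\<And>P x. \<phi> P (x mod int P) = \<phi> P x"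
  shows "(\<Sum>x\<in>{0..<int (\<Prod>I)}. \<Prod>P\<in>I. \<phi> P x) = (\<Prod>P\<in>I. \<Sum>x\<in>{0..<int P}. \<phi> P x)"
  using assms(1,2)
proof (induction I rule: finite_induct)
  case empty
  have "{0..<1} = {0::int}" by auto
  then show ?case by simp
next
  case (insert P I)
  have "coprime P (\<Prod>I)"
    using insert by (intro prod_coprime_right) (auto intro!: primes_coprime)
  moreover have "P > 0" "\<Prod>I > 0"
    using insert.prems by (auto intro!: prod_pos simp: prime_gt_0_nat)
  moreover have "(\<Prod>q\<in>I. \<phi> q (x mod int (\<Prod>I))) = (\<Prod>q\<in>I. \<phi> q x)" for x
  proof (rule prod.cong)
    fix q assume q: "q \<in> I"
    have "int q dvd int (\<Prod>I)"
      unfolding int_dvd_int_iff using dvd_prodI[OF insert.hyps(1) q, of "\<lambda>q. q"] by simp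
    then have "x mod int (\<Prod>I) mod int q = x mod int q" by (rule mod_mod_cancel)
    then show "\<phi> q (x mod int (\<Prod>I)) = \<phi> q x" by (metis assms(3))
  qed simp
  ultimately have "(\<Sum>x\<in>{0..<int (P * \<Prod>I)}. \<phi> P x * (\<Prod>q\<in>I. \<phi> q x))
      = (\<Sum>x\<in>{0..<int P}. \<phi> P x) * (\<Sum>x\<in>{0..<int (\<Prod>I)}. \<Prod>q\<in>I. \<phi> q x)"
    using assms(3) by (intro sum_mult_coprime_periods) auto
  then show ?case using insert by simp
qed

lemma sum_mean_zero_step_powr:
  fixes c p :: real
  assumes "P > 0"
  shows "(\<Sum>x\<in>{0..<int P}. \<bar>mean_zero_step P x + c\<bar> powr p)
    = real (P div 3) * \<bar>1 - real (P div 3) / real P + c\<bar> powr p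
      + (real P - real (P div 3)) * \<bar>c - real (P div 3) / real P\<bar> powr p"
proof -
  let ?a = "P div 3"
  let ?f = "\<lambda>x. \<bar>mean_zero_step P x + c\<bar> powr p"
  have le: "?a \<le> P" by simp
  have "{0..<int P} = {0..<int ?a} \<union> {int ?a..<int P}" using le by auto
  then have "sum ?f {0..<int P} = sum ?f {0..<int ?a} + sum ?f {int ?a..<int P}"
    by (simp only:) (rule sum.union_disjoint, auto)
  also have "sum ?f {0..<int ?a} = (\<Sum>x\<in>{0..<int ?a}. \<bar>1 - real ?a / real P + c\<bar> powr p)"
    using le by (intro sum.cong refl) (auto simp: mean_zero_step_def simp del: of_nat_div)
  also have "sum ?f {int ?a..<int P} = (\<Sum>x\<in>{int ?a..<int P}. \<bar>c - real ?a / real P\<bar> powr p)"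
    using le by (intro sum.cong refl) (auto simp: mean_zero_step_def simp del: of_nat_div)
  finally show ?thesis using le by (simp add: of_nat_diff nat_diff_distrib del: of_nat_div)
qed

section \<open>Fourier inversion for smooth periodic functions\<close>

lemma has_vector_derivative_e_char:
  "((\<lambda>\<xi>. e_char (k * \<xi>)) has_vector_derivative (2 * of_real pi * \<i> * of_real k) * e_char (k * \<xi>))
     (at \<xi> within S)"
proof -
  have "(\<lambda>\<xi>. e_char (k * \<xi>)) = (\<lambda>\<xi>. exp (\<xi> *\<^sub>R (2 * of_real pi * \<i> * of_real k)))"
    by (simp add: e_char_def scaleR_conv_of_real mult_ac)
  then show ?thesis
    using exp_scaleR_has_vector_derivative_right[of "2 * of_real pi * \<i> * of_real k" \<xi> S]
    by (simp add: e_char_def scaleR_conv_of_real mult_ac)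
qed

text \<open>Stated with a complex quotient, as needed at the removable singularity in the proof of
  Fourier inversion.\<close>

lemma has_vector_derivative_difference_quotient:
  fixes f :: "real \<Rightarrow> complex"
  assumes "(f has_vector_derivative d) (at x)"
  shows "((\<lambda>y. (f y - f x) / of_real (y - x)) \<longlongrightarrow> d) (at x)"
proof -
  have "((\<lambda>y. norm ((f y - f x) - (y - x) *\<^sub>R d) / norm (y - x)) \<longlongrightarrow> 0) (at x)"
    using assms unfolding has_vector_derivative_def has_derivative_iff_norm by simp
  moreover have "\<forall>\<^sub>F y in at x. norm ((f y - f x) - (y - x) *\<^sub>R d) / norm (y - x)
      = norm ((f y - f x) / of_real (y - x) - d)"
    unfolding eventually_at_filter
  proof (intro always_eventually allI impI)
    fix y assume "y \<noteq> x"
    then have "(f y - f x) / of_real (y - x) - d = ((f y - f x) - (y - x) *\<^sub>R d) / of_real (y - x)"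
      by (simp add: scaleR_conv_of_real diff_divide_distrib del: of_real_diff)
    then show "norm ((f y - f x) - (y - x) *\<^sub>R d) / norm (y - x) = norm ((f y - f x) / of_real (y - x) - d)"
      by (simp add: norm_divide del: of_real_diff)
  qed
  ultimately have "((\<lambda>y. norm ((f y - f x) / of_real (y - x) - d)) \<longlongrightarrow> 0) (at x)"
    by (rule Lim_transform_eventually)
  then have "((\<lambda>y. (f y - f x) / of_real (y - x) - d) \<longlongrightarrow> 0) (at x)"
    by (rule tendsto_norm_zero_cancel)
  then show ?thesis by (simp add: LIM_zero_cancel)
qed

lemma integral_e_char_parts:
  fixes M M' :: "real \<Rightarrow> complex"
  assumes M: "\<And>x. (M has_vector_derivative M' x) (at x)"
    and cont: "continuous_on UNIV M'" and "k \<noteq> 0" and "a \<le> b"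
  defines "w \<equiv> 2 * of_real pi * \<i> * of_real k"
  shows "integral {a..b} (\<lambda>\<xi>. M \<xi> * e_char (k * \<xi>))
    = (M b * e_char (k * b) - M a * e_char (k * a)) / w
         - integral {a..b} (\<lambda>\<xi>. M' \<xi> * e_char (k * \<xi>)) / w"
proof -
  have w: "w \<noteq> 0" using \<open>k \<noteq> 0\<close> by (simp add: w_def)
  have cM: "continuous_on UNIV M"
    using M by (meson continuous_at_imp_continuous_on has_vector_derivative_continuous)
  have int: "(\<lambda>\<xi>. f \<xi> * e_char (k * \<xi>)) integrable_on {a..b}"
    if "continuous_on UNIV f" for f :: "real \<Rightarrow> complex"
    by (intro integrable_continuous_real continuous_intros continuous_on_subset[OF that]) auto
  have "((\<lambda>\<xi>. M \<xi> * (w * e_char (k * \<xi>)) + M' \<xi> * e_char (k * \<xi>)) has_integral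
      (M b * e_char (k * b) - M a * e_char (k * a))) {a..b}"
    unfolding w_def using \<open>a \<le> b\<close>
    by (intro fundamental_theorem_of_calculus has_vector_derivative_mult
        has_vector_derivative_e_char has_vector_derivative_at_within[OF M]) auto
  then have "M b * e_char (k * b) - M a * e_char (k * a)
      = integral {a..b} (\<lambda>\<xi>. w * (M \<xi> * e_char (k * \<xi>)) + M' \<xi> * e_char (k * \<xi>))"
    by (simp add: integral_unique algebra_simps)
  also have "\<dots> = w * integral {a..b} (\<lambda>\<xi>. M \<xi> * e_char (k * \<xi>))
      + integral {a..b} (\<lambda>\<xi>. M' \<xi> * e_char (k * \<xi>))"
    using int[OF cM] int[OF cont]
    by (subst Henstock_Kurzweil_Integration.integral_add) (auto intro: integrable_on_mult_right)
  finally show ?thesis using w by (simp add: field_simps)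
qed

lemma cmod_two_pi_i: "cmod (2 * of_real pi * \<i> * of_real k) = 2 * pi * \<bar>k\<bar>"
  by (simp add: norm_mult)

lemma norm_integral_e_char_le:
  fixes f :: "real \<Rightarrow> complex"
  assumes "continuous_on {-1/2..1/2} f" "\<And>\<xi>. \<xi> \<in> {-1/2..1/2} \<Longrightarrow> norm (f \<xi>) \<le> B"
  shows "norm (integral {-1/2..1/2} (\<lambda>\<xi>. f \<xi> * e_char (k * \<xi>))) \<le> B"
proof -
  have "norm (integral {-1/2..1/2} (\<lambda>\<xi>. f \<xi> * e_char (k * \<xi>))) \<le> B * (1/2 - (-1/2))"
    by (rule integral_bound) (use assms in \<open>auto intro!: continuous_intros simp: norm_mult\<close>)
  then show ?thesis by simp
qed

lemma continuous_bounded_on_interval: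
  fixes f :: "real \<Rightarrow> complex"
  assumes "continuous_on {a..b} f"
  obtains B where "B > 0" "\<And>\<xi>. \<xi> \<in> {a..b} \<Longrightarrow> norm (f \<xi>) \<le> B"
  using compact_imp_bounded[OF compact_continuous_image[OF assms compact_Icc]]
  unfolding bounded_pos by auto

text \<open>A polynomial within \<open>e / 2\<close> of \<open>h\<close> uniformly reduces the claim
  to smooth functions, where one integration by parts gives decay of order \<open>1 / k\<close>. The
  sequence \<open>s\<close> allows frequencies tending to either infinity.\<close>

lemma Riemann_Lebesgue_continuous:
  fixes h :: "real \<Rightarrow> complex" and s :: "nat \<Rightarrow> int"
  assumes h: "continuous_on {-1/2..1/2} h"
    and s: "filterlim (\<lambda>m. \<bar>real_of_int (s m)\<bar>) at_top sequentially"
  shows "(\<lambda>m. integral {-1/2..1/2} (\<lambda>\<xi>. h \<xi> * e_char (of_int (s m) * \<xi>))) \<longlonglongrightarrow> 0"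
proof (rule tendstoI)
  fix e :: real assume e: "e > 0"
  let ?I = "{-1/2..1/2::real}"
  obtain P where P: "polynomial_function P" "\<And>x. x \<in> ?I \<Longrightarrow> norm (h x - P x) < e / 2"
    using Stone_Weierstrass_polynomial_function[OF compact_Icc h, of "e/2"] e by auto
  obtain P' where P': "polynomial_function P'" "\<And>x. (P has_vector_derivative P' x) (at x)"
    using has_vector_derivative_polynomial_function[OF P(1)] by blast
  have cont: "continuous_on A P" "continuous_on A P'" for A
    using P(1) P'(1) by (auto intro: continuous_on_polymonial_function)
  obtain B where B: "B > 0" "\<And>\<xi>. \<xi> \<in> ?I \<Longrightarrow> norm (P \<xi>) \<le> B"
    using continuous_bounded_on_interval[OF cont(1)] by blast
  obtain B' where B': "B' > 0" "\<And>\<xi>. \<xi> \<in> ?I \<Longrightarrow> norm (P' \<xi>) \<le> B'"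
    using continuous_bounded_on_interval[OF cont(2)] by blast
  have bound: "norm (integral ?I (\<lambda>\<xi>. P \<xi> * e_char (k * \<xi>))) \<le> (2 * B + B') / \<bar>k\<bar>" if "k \<noteq> 0" for k
  proof -
    let ?w = "2 * of_real pi * \<i> * of_real k :: complex"
    let ?R = "P (1/2) * e_char (k * (1/2)) - P (-1/2) * e_char (k * (-1/2))"
    let ?J = "integral ?I (\<lambda>\<xi>. P' \<xi> * e_char (k * \<xi>))"
    have "norm ?R \<le> norm (P (1/2) * e_char (k * (1/2))) + norm (P (-1/2) * e_char (k * (-1/2)))"
      by (rule norm_triangle_ineq4)
    also have "\<dots> \<le> B + B" using B(2) by (intro add_mono) (auto simp: norm_mult)
    finally have R: "norm ?R \<le> 2 * B" by simp
    have J: "norm ?J \<le> B'" by (intro norm_integral_e_char_le cont B'(2))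
    have "integral ?I (\<lambda>\<xi>. P \<xi> * e_char (k * \<xi>)) = (?R - ?J) / ?w"
      using integral_e_char_parts[OF P'(2) cont(2) that, of "-1/2" "1/2"]
      by (simp add: diff_divide_distrib)
    also have "norm \<dots> \<le> (2 * B + B') / (2 * pi * \<bar>k\<bar>)"
      unfolding norm_divide cmod_two_pi_i
      using R J norm_triangle_ineq4[of ?R ?J] by (intro divide_right_mono) auto
    also have "\<dots> \<le> (2 * B + B') / \<bar>k\<bar>"
    proof (intro divide_left_mono)
      have "1 * \<bar>k\<bar> \<le> 2 * pi * \<bar>k\<bar>" using pi_ge_two by (intro mult_right_mono) auto
      then show "\<bar>k\<bar> \<le> 2 * pi * \<bar>k\<bar>" by simp
    qed (use that B B' in auto)
    finally show ?thesis .
  qed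
  have "\<forall>\<^sub>F m in sequentially. \<bar>real_of_int (s m)\<bar> > 2 * (2 * B + B') / e"
    using s unfolding filterlim_at_top_dense by blast
  then show "\<forall>\<^sub>F m in sequentially.
     dist (integral ?I (\<lambda>\<xi>. h \<xi> * e_char (of_int (s m) * \<xi>))) 0 < e"
  proof eventually_elim
    case (elim m)
    define k where "k = real_of_int (s m)"
    have "2 * (2 * B + B') / e > 0" using B B' e by auto
    then have k: "\<bar>k\<bar> > 0" using elim unfolding k_def by linarith
    have "(2 * B + B') / \<bar>k\<bar> < e / 2" using elim k e unfolding k_def
      by (simp add: field_simps)
    then have b: "norm (integral ?I (\<lambda>\<xi>. P \<xi> * e_char (k * \<xi>))) < e / 2"
      using k by (intro le_less_trans[OF bound]) auto
    have "integral ?I (\<lambda>\<xi>. h \<xi> * e_char (k * \<xi>))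
        = integral ?I (\<lambda>\<xi>. (h \<xi> - P \<xi>) * e_char (k * \<xi>) + P \<xi> * e_char (k * \<xi>))"
      by (simp add: algebra_simps)
    also have "\<dots> = integral ?I (\<lambda>\<xi>. (h \<xi> - P \<xi>) * e_char (k * \<xi>))
        + integral ?I (\<lambda>\<xi>. P \<xi> * e_char (k * \<xi>))"
      by (intro Henstock_Kurzweil_Integration.integral_add integrable_continuous_real continuous_intros h cont)
    also have "norm \<dots> \<le> norm (integral ?I (\<lambda>\<xi>. (h \<xi> - P \<xi>) * e_char (k * \<xi>)))
        + norm (integral ?I (\<lambda>\<xi>. P \<xi> * e_char (k * \<xi>)))" by (rule norm_triangle_ineq)
    also have "\<dots> < e / 2 + e / 2"
    proof (rule add_le_less_mono[OF _ b])
      show "norm (integral ?I (\<lambda>\<xi>. (h \<xi> - P \<xi>) * e_char (k * \<xi>))) \<le> e / 2"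
        by (intro norm_integral_e_char_le continuous_intros h cont) (use P(2) in \<open>auto simp: less_imp_le\<close>)
    qed
    finally show ?case by (simp add: k_def)
  qed
qed

text \<open>Lets an unconditional sum over the integers be computed along symmetric partial
  sums.\<close>

lemma filterlim_symmetric_int_intervals:
  "filterlim (\<lambda>m. {- int m..int m}) (finite_subsets_at_top UNIV) sequentially"
  unfolding filterlim_finite_subsets_at_top
proof (intro allI impI)
  fix X :: "int set" assume X: "finite X \<and> X \<subseteq> UNIV"
  define m0 where "m0 = nat (\<Sum>x\<in>X. \<bar>x\<bar>)"
  show "\<forall>\<^sub>F m in sequentially. finite {- int m..int m} \<and> X \<subseteq> {- int m..int m} \<and> {- int m..int m} \<subseteq> UNIV"
    using eventually_ge_at_top[of m0]
  proof eventually_elim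
    case (elim m)
    have "\<bar>x\<bar> \<le> int m" if "x \<in> X" for x
      using member_le_sum[of x X "\<lambda>x. \<bar>x\<bar>"] X that elim unfolding m0_def by auto
    then show ?case by (auto simp: abs_le_iff) (metis minus_le_iff)
  qed
qed

lemma summable_on_int_inverse_square: "(\<lambda>n::int. 1 / (real_of_int n)\<^sup>2) summable_on UNIV"
proof -
  have nat: "(\<lambda>n::nat. 1 / (real n)\<^sup>2) summable_on UNIV"
    using inverse_power_summable[of 2, where 'a = real]
    by (intro norm_summable_imp_summable_on) (simp add: inverse_eq_divide)
  have "(\<lambda>n::int. 1 / (real_of_int n)\<^sup>2) summable_on (range int)"
    by (subst summable_on_reindex) (auto simp: o_def nat)
  moreover have "(\<lambda>n::int. 1 / (real_of_int n)\<^sup>2) summable_on (range (\<lambda>n. - int n))"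
    by (subst summable_on_reindex) (auto simp: o_def nat inj_def)
  ultimately have "(\<lambda>n::int. 1 / (real_of_int n)\<^sup>2) summable_on (range int \<union> range (\<lambda>n. - int n))"
    by (rule summable_on_union)
  moreover have "range int \<union> range (\<lambda>n. - int n) = UNIV"
  proof -
    have "x \<in> range int \<union> range (\<lambda>n. - int n)" for x by (cases x rule: int_cases2) auto
    then show ?thesis by blast
  qed
  ultimately show ?thesis by simp
qed

text \<open>The two endpoint conditions cancel the boundary terms in two integrations by parts. This
  gives coefficients of order \<open>1 / n^2\<close>, enough for absolute summability.\<close>

locale smooth_periodic =
  fixes M M' M'' :: "real \<Rightarrow> complex"
  assumes deriv1: "\<And>x. (M has_vector_derivative M' x) (at x)"
    and deriv2: "\<And>x. (M' has_vector_derivative M'' x) (at x)"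
    and cont2: "continuous_on UNIV M''"
    and endpoints: "M (1/2) = M (-1/2)" "M' (1/2) = M' (-1/2)"
begin

text \<open>The sign is that of the inverse transform, so that these are the values of the
  convolution kernel of the multiplier M; the inversion formula carries the opposite sign.\<close>

definition coeff where "coeff n = integral {-1/2..1/2} (\<lambda>\<xi>. M \<xi> * e_char (of_int n * \<xi>))" for n :: int

lemma cont: "continuous_on A M"
  using deriv1 by (meson continuous_at_imp_continuous_on has_vector_derivative_continuous)

lemma cont1: "continuous_on A M'"
  using deriv2 by (meson continuous_at_imp_continuous_on has_vector_derivative_continuous)

lemma e_char_half: "e_char (of_int n / 2) = e_char (- (of_int n / 2))"
proof -
  have "e_char (of_int n / 2) = e_char (- (of_int n / 2) + of_int n)" by simp
  then show ?thesis by (simp only: e_char_add e_char_of_int mult_1_right)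
qed

lemma norm_coeff_le: "\<exists>B>0. \<forall>n. n \<noteq> 0 \<longrightarrow> norm (coeff n) \<le> B / (of_int n)\<^sup>2"
proof -
  obtain B where B: "B > 0" "\<And>\<xi>. \<xi> \<in> {-1/2..1/2} \<Longrightarrow> norm (M'' \<xi>) \<le> B"
    using continuous_bounded_on_interval[OF continuous_on_subset[OF cont2]] by blast
  have "norm (coeff n) \<le> B / (of_int n)\<^sup>2" if n: "n \<noteq> 0" for n
  proof -
    let ?w = "2 * of_real pi * \<i> * of_real (of_int n) :: complex"
    let ?J = "integral {-1/2..1/2} (\<lambda>\<xi>. M'' \<xi> * e_char (of_int n * \<xi>))"
    have "coeff n = - integral {-1/2..1/2} (\<lambda>\<xi>. M' \<xi> * e_char (of_int n * \<xi>)) / ?w"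
      using integral_e_char_parts[OF deriv1 cont1, of "of_int n" "-1/2" "1/2"] n endpoints
      by (simp add: coeff_def e_char_half)
    also have "integral {-1/2..1/2} (\<lambda>\<xi>. M' \<xi> * e_char (of_int n * \<xi>)) = - ?J / ?w"
      using integral_e_char_parts[OF deriv2 cont2, of "of_int n" "-1/2" "1/2"] n endpoints
      by (simp add: e_char_half)
    finally have "coeff n = ?J / ?w\<^sup>2" by (simp add: power2_eq_square)
    also have "norm \<dots> \<le> B / (2 * pi * \<bar>of_int n\<bar>)\<^sup>2"
      unfolding norm_divide norm_power cmod_two_pi_i
      using B by (intro divide_right_mono norm_integral_e_char_le continuous_on_subset[OF cont2]) auto
    also have "\<dots> \<le> B / (of_int n)\<^sup>2"
    proof (rule divide_left_mono)
      have "1 * \<bar>of_int n\<bar> \<le> 2 * pi * \<bar>of_int n :: real\<bar>" using pi_ge_two by (intro mult_right_mono) auto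
      then have "\<bar>of_int n\<bar>\<^sup>2 \<le> (2 * pi * \<bar>of_int n :: real\<bar>)\<^sup>2" by (intro power_mono) auto
      then show "(of_int n)\<^sup>2 \<le> (2 * pi * \<bar>of_int n :: real\<bar>)\<^sup>2" by simp
    qed (use n B in auto)
    finally show ?thesis .
  qed
  then show ?thesis using B(1) by blast
qed

lemma coeff_abs_summable: "(\<lambda>n. norm (coeff n)) summable_on UNIV"
proof -
  obtain B where B: "B > 0" "\<And>n. n \<noteq> 0 \<Longrightarrow> norm (coeff n) \<le> B * (1 / (of_int n)\<^sup>2)"
    using norm_coeff_le by auto
  have "(\<lambda>n. norm (coeff n)) summable_on (UNIV - {0})"
  proof (rule Infinite_Sum.abs_summable_on_comparison_test')
    show "(\<lambda>n::int. B * (1 / (real_of_int n)\<^sup>2)) summable_on (UNIV - {0})"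
      by (intro summable_on_cmult_right summable_on_subset_banach[OF summable_on_int_inverse_square]) auto
  qed (use B(2) in auto)
  moreover have "(\<lambda>n. norm (coeff n)) summable_on {0}" by (rule summable_on_finite) simp
  ultimately have "(\<lambda>n. norm (coeff n)) summable_on (UNIV - {0} \<union> {0})"
    by (rule summable_on_union)
  then show ?thesis by simp
qed

text \<open>Dividing \<open>M \<xi> - M \<theta>\<close> by \<open>e(\<xi> - \<theta>) - 1\<close> makes the symmetric partial sums telescope, so that
  convergence reduces to the Riemann--Lebesgue lemma.\<close>
lemma symmetric_partial_sums_tendsto:
  assumes \<theta>: "-1/2 < \<theta>" "\<theta> < 1/2"
  shows "(\<lambda>m. \<Sum>n\<in>{- int m..int m}. coeff n * e_char (- (of_int n * \<theta>))) \<longlonglongrightarrow> M \<theta>"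
proof -
  let ?I = "{-1/2..1/2::real}"
  \<comment> \<open>The value at \<open>\<theta>\<close> is the limit of the quotient, since
    \<open>e_char (\<xi> - \<theta>)\<close> has derivative \<open>2 pi i\<close> there. As
    \<open>\<theta>\<close> is interior, the denominator has no other zero on the closed
    interval.\<close>
  define h where "h \<xi> = (if \<xi> = \<theta> then M' \<theta> / (2 * of_real pi * \<i>)
      else (M \<xi> - M \<theta>) / (e_char (\<xi> - \<theta>) - 1))" for \<xi>
  have ne: "e_char (\<xi> - \<theta>) \<noteq> 1" if "\<xi> \<in> ?I" "\<xi> \<noteq> \<theta>" for \<xi>
  proof
    assume "e_char (\<xi> - \<theta>) = 1"
    then obtain m :: int where m: "\<xi> - \<theta> = of_int m"
      unfolding e_char_eq_1_iff by (auto elim: Ints_cases)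
    have "\<bar>\<xi> - \<theta>\<bar> < 1" using that \<theta> by auto
    then have "m = 0" unfolding m by linarith
    then show False using m that by simp
  qed
  have h_mult: "h \<xi> * (e_char (\<xi> - \<theta>) - 1) = M \<xi> - M \<theta>" if "\<xi> \<in> ?I" for \<xi>
    using ne[OF that] by (cases "\<xi> = \<theta>") (auto simp: h_def)
  have conth: "continuous_on ?I h"
  proof (intro continuous_at_imp_continuous_on ballI)
    fix x assume x: "x \<in> ?I"
    show "isCont h x"
    proof (cases "x = \<theta>")
      case True
      have "((\<lambda>\<xi>. e_char (1 * (\<xi> - \<theta>))) has_vector_derivative 2 * of_real pi * \<i> * of_real 1 * e_char (1 * (\<theta> - \<theta>))) (at \<theta>)"
      proof -
        have "((\<lambda>\<xi>. e_char (1 * \<xi>) * e_char (- \<theta>)) has_vector_derivative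
            (2 * of_real pi * \<i> * of_real 1 * e_char (1 * \<theta>)) * e_char (- \<theta>)) (at \<theta>)"
          by (intro has_vector_derivative_mult_left has_vector_derivative_e_char)
        moreover have "e_char (1 * (\<xi> - \<theta>)) = e_char (1 * \<xi>) * e_char (- \<theta>)" for \<xi>
          by (simp flip: e_char_add)
        ultimately show ?thesis by (simp only: mult.assoc)
      qed
      from has_vector_derivative_difference_quotient[OF this]
      have e: "((\<lambda>y. (e_char (y - \<theta>) - 1) / of_real (y - \<theta>)) \<longlongrightarrow> 2 * of_real pi * \<i>) (at \<theta>)"
        by simp
      have "((\<lambda>y. ((M y - M \<theta>) / of_real (y - \<theta>)) / ((e_char (y - \<theta>) - 1) / of_real (y - \<theta>)))
          \<longlongrightarrow> M' \<theta> / (2 * of_real pi * \<i>)) (at \<theta>)"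
        by (intro tendsto_divide e has_vector_derivative_difference_quotient[OF deriv1]) simp
      then have "(h \<longlongrightarrow> M' \<theta> / (2 * of_real pi * \<i>)) (at \<theta>)"
        by (rule Lim_transform_eventually) (auto simp: eventually_at_filter h_def)
      then show ?thesis unfolding True isCont_def by (simp add: h_def)
    next
      case False
      have "isCont (\<lambda>\<xi>. (M \<xi> - M \<theta>) / (e_char (\<xi> - \<theta>) - 1)) x"
        using ne[OF x False] cont[of UNIV] continuous_on_e_char[of UNIV "\<lambda>\<xi>. \<xi> - \<theta>"]
        by (intro continuous_intros) (auto simp: continuous_on_eq_continuous_at intro!: continuous_intros)
      moreover have "\<forall>\<^sub>F \<xi> in nhds x. (M \<xi> - M \<theta>) / (e_char (\<xi> - \<theta>) - 1) = h \<xi>"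
        using t1_space_nhds[OF False] by eventually_elim (simp add: h_def)
      ultimately show ?thesis by (simp add: isCont_cong)
    qed
  qed
  define J where "J n = integral ?I (\<lambda>\<xi>. h \<xi> * e_char (of_int n * \<xi>)) * e_char (- (of_int n * \<theta>))" for n :: int
  have Jint: "J n = integral ?I (\<lambda>\<xi>. h \<xi> * e_char (of_int n * (\<xi> - \<theta>)))" for n
    unfolding J_def right_diff_distrib
    by (subst integral_mult_left[symmetric]) (simp add: mult.assoc flip: e_char_add)
  have intc: "integral ?I (\<lambda>\<xi>. e_char (of_int n * (\<xi> - \<theta>))) = (if n = 0 then 1 else 0)" for n
  proof (cases "n = 0")
    case False
    have "integral ?I (\<lambda>\<xi>. 1 * e_char (of_int n * \<xi>)) = 0"
      using integral_e_char_parts[of "\<lambda>_. 1" "\<lambda>_. 0" "of_int n" "-1/2" "1/2"] False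
      by (simp add: e_char_half)
    moreover have "integral ?I (\<lambda>\<xi>. e_char (of_int n * (\<xi> - \<theta>)))
       = integral ?I (\<lambda>\<xi>. 1 * e_char (of_int n * \<xi>)) * e_char (- (of_int n * \<theta>))"
      by (subst integral_mult_left[symmetric]) (simp add: right_diff_distrib flip: e_char_add)
    ultimately show ?thesis using False by simp
  qed simp
  have conte: "continuous_on ?I (\<lambda>\<xi>. e_char (of_int n * (\<xi> - \<theta>)))" for n :: int
    by (intro continuous_intros)
  \<comment> \<open>Multiply \<open>M \<xi> = h \<xi> * (e_char (\<xi> - \<theta>) - 1) + M
    \<theta>\<close> by the n-th character and integrate: the factor raises the index of
    \<open>J\<close> by one, and the constant survives only for \<open>n = 0\<close>.\<close>
  have step: "coeff n * e_char (- (of_int n * \<theta>)) = J (n + 1) - J n + (if n = 0 then M \<theta> else 0)" for n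
  proof -
    have distrib: "(a * (b - 1) + c) * d = (a * (b * d) - a * d) + c * d" for a b c d :: complex
      by (simp add: algebra_simps)
    have "coeff n * e_char (- (of_int n * \<theta>)) = integral ?I (\<lambda>\<xi>. M \<xi> * e_char (of_int n * (\<xi> - \<theta>)))"
      unfolding coeff_def right_diff_distrib
      by (subst integral_mult_left[symmetric]) (simp add: mult.assoc flip: e_char_add)
    also have "\<dots> = integral ?I (\<lambda>\<xi>. (h \<xi> * e_char (of_int (n + 1) * (\<xi> - \<theta>))
        - h \<xi> * e_char (of_int n * (\<xi> - \<theta>))) + M \<theta> * e_char (of_int n * (\<xi> - \<theta>)))"
    proof (rule Henstock_Kurzweil_Integration.integral_cong)
      fix \<xi> assume "\<xi> \<in> ?I"
      then have "M \<xi> = h \<xi> * (e_char (\<xi> - \<theta>) - 1) + M \<theta>" using h_mult by simp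
      moreover have "e_char (of_int (n + 1) * (\<xi> - \<theta>)) = e_char (\<xi> - \<theta>) * e_char (of_int n * (\<xi> - \<theta>))"
        unfolding e_char_add[symmetric] by (rule arg_cong[of _ _ e_char]) (simp add: algebra_simps)
      ultimately show "M \<xi> * e_char (of_int n * (\<xi> - \<theta>)) = (h \<xi> * e_char (of_int (n + 1) * (\<xi> - \<theta>))
        - h \<xi> * e_char (of_int n * (\<xi> - \<theta>))) + M \<theta> * e_char (of_int n * (\<xi> - \<theta>))"
        by (simp only: distrib)
    qed
    also have "\<dots> = J (n + 1) - J n + M \<theta> * integral ?I (\<lambda>\<xi>. e_char (of_int n * (\<xi> - \<theta>)))"
      unfolding Jint
      by (subst Henstock_Kurzweil_Integration.integral_add, (intro integrable_continuous_real continuous_intros conth conte)+)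
        (subst Henstock_Kurzweil_Integration.integral_diff, (intro integrable_continuous_real continuous_intros conth conte)+, simp)
    finally show ?thesis unfolding intc by simp
  qed
  have tele: "(\<Sum>n\<in>{- int m..int m}. coeff n * e_char (- (of_int n * \<theta>)))
      = J (int m + 1) - J (- int m) + M \<theta>" for m
  proof (induction m)
    case 0
    then show ?case using step[of 0] by simp
  next
    case (Suc m)
    have "{- int (Suc m)..int (Suc m)} = insert (- int m - 1) (insert (int m + 1) {- int m..int m})"
      by auto
    then have "sum f {- int (Suc m)..int (Suc m)} = f (- int m - 1) + (f (int m + 1) + sum f {- int m..int m})"
      for f :: "int \<Rightarrow> complex" by simp
    moreover have "coeff (int m + 1) * e_char (- (of_int (int m + 1) * \<theta>)) = J (int (Suc m) + 1) - J (int m + 1)"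
      using step[of "int m + 1"] by (simp add: add.commute)
    moreover have "coeff (- int m - 1) * e_char (- (of_int (- int m - 1) * \<theta>)) = J (- int m) - J (- int (Suc m))"
    proof -
      have "- int (Suc m) = - int m - 1" by simp
      then show ?thesis using step[of "- int m - 1"] by (simp only:) simp
    qed
    ultimately show ?case using Suc.IH by (simp only:) simp
  qed
  have lim: "(\<lambda>m. J (s m)) \<longlonglongrightarrow> 0"
    if "filterlim (\<lambda>m. \<bar>real_of_int (s m)\<bar>) at_top sequentially" for s :: "nat \<Rightarrow> int"
  proof -
    have "(\<lambda>m. norm (integral ?I (\<lambda>\<xi>. h \<xi> * e_char (of_int (s m) * \<xi>)))) \<longlonglongrightarrow> 0"
      using Riemann_Lebesgue_continuous[OF conth that] by (rule tendsto_norm_zero)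
    then have "(\<lambda>m. norm (J (s m))) \<longlonglongrightarrow> 0" by (simp add: J_def norm_mult)
    then show ?thesis by (rule tendsto_norm_zero_cancel)
  qed
  have at: "filterlim (\<lambda>m. real m) at_top sequentially" by (rule filterlim_real_sequentially)
  have "(\<lambda>m. J (int m + 1)) \<longlonglongrightarrow> 0"
    by (rule lim, rule filterlim_at_top_mono[OF at]) (auto intro!: always_eventually)
  moreover have "(\<lambda>m. J (- int m)) \<longlonglongrightarrow> 0"
    by (rule lim, rule filterlim_at_top_mono[OF at]) (auto intro!: always_eventually)
  ultimately have "(\<lambda>m. J (int m + 1) - J (- int m) + M \<theta>) \<longlonglongrightarrow> 0 - 0 + M \<theta>"
    by (intro tendsto_intros)
  then show ?thesis by (simp add: tele)
qed

text \<open>Absolute summability makes the order of summation irrelevant, so the symmetric limit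
  identifies the sum. The endpoint -1/2 is excluded, which is why the denominators are kept odd
  later.\<close>

lemma Fourier_inversion:
  assumes \<theta>: "-1/2 < \<theta>" "\<theta> < 1/2"
  shows "((\<lambda>n. coeff n * e_char (- (of_int n * \<theta>))) has_sum M \<theta>) UNIV"
proof -
  let ?f = "\<lambda>n. coeff n * e_char (- (of_int n * \<theta>))"
  have "(\<lambda>n. norm (?f n)) summable_on UNIV"
    using coeff_abs_summable by (simp add: norm_mult)
  then have "?f summable_on UNIV" by (rule abs_summable_summable)
  then have hs: "(?f has_sum infsum ?f UNIV) UNIV" by simp
  then have "(sum ?f \<longlongrightarrow> infsum ?f UNIV) (finite_subsets_at_top UNIV)" by (simp add: has_sum_def)
  then have "(\<lambda>m. sum ?f {- int m..int m}) \<longlonglongrightarrow> infsum ?f UNIV"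
    by (rule filterlim_compose[OF _ filterlim_symmetric_int_intervals])
  then have "infsum ?f UNIV = M \<theta>"
    using symmetric_partial_sums_tendsto[OF assms] by (rule LIMSEQ_unique)
  then show ?thesis using hs by simp
qed

end

section \<open>The multiplier operator on finitely supported functions\<close>

lemma finite_measure_torus: "finite_measure torus"
  unfolding torus_def
  by (rule finite_measureI) (simp add: emeasure_restrict_space space_restrict_space)

lemma integrable_torus_bounded:
  fixes g :: "real \<Rightarrow> complex"
  assumes "g \<in> borel_measurable torus" "\<And>\<xi>. norm (g \<xi>) \<le> B"
  shows "integrable torus g"
  by (rule finite_measure.integrable_const_bound[OF finite_measure_torus, of _ B]) (use assms in auto)

lemma borel_measurable_torusI: "g \<in> borel_measurable borel \<Longrightarrow> g \<in> borel_measurable torus"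
  unfolding torus_def by (intro measurable_restrict_space1) simp

lemma fourier_Z_l1_finite:
  assumes "finite S" "\<And>y. y \<notin> S \<Longrightarrow> f y = 0"
  shows "fourier_Z_l1 f = (\<lambda>\<xi>. \<Sum>y\<in>S. f y * e_char (- (of_int y * \<xi>)))"
proof
  fix \<xi>
  have "fourier_Z_l1 f \<xi> = infsum (\<lambda>y. f y * e_char (- (of_int y * \<xi>))) S"
    unfolding fourier_Z_l1_def by (rule infsum_cong_neutral) (use assms in auto)
  then show "fourier_Z_l1 f \<xi> = (\<Sum>y\<in>S. f y * e_char (- (of_int y * \<xi>)))"
    using assms(1) by simp
qed

text \<open>The truncations of f are eventually f itself, so the limit in
  \<open>is_fourier_Z\<close> is the squared distance from the finite sum to the chosen
  representative. That distance is therefore 0, whatever \<open>SOME\<close> selects.\<close>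

lemma fourier_Z_finite_AE:
  fixes f :: "int \<Rightarrow> complex"
  assumes S: "finite S" "\<And>y. y \<notin> S \<Longrightarrow> f y = 0"
  shows "fourier_Z f \<in> borel_measurable torus"
    and "AE \<xi> in torus. fourier_Z f \<xi> = (\<Sum>y\<in>S. f y * e_char (- (of_int y * \<xi>)))"
proof -
  define F where "F \<xi> = (\<Sum>y\<in>S. f y * e_char (- (of_int y * \<xi>)))" for \<xi>
  have Fl1: "fourier_Z_l1 f = F" using fourier_Z_l1_finite[OF S] by (simp add: F_def fun_eq_iff)
  have meas: "F \<in> borel_measurable torus"
    unfolding F_def by (rule borel_measurable_torusI) measurable
  have Fb: "norm (F \<xi>) \<le> (\<Sum>y\<in>S. norm (f y))" for \<xi>
    unfolding F_def by (rule order_trans[OF norm_sum]) (simp add: norm_mult)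
  have F2: "integrable torus (\<lambda>\<xi>. (cmod (F \<xi>))\<^sup>2)"
    by (rule finite_measure.integrable_const_bound[OF finite_measure_torus, of _ "(\<Sum>y\<in>S. norm (f y))\<^sup>2"])
      (use meas Fb in \<open>auto intro!: power_mono borel_measurable_power borel_measurable_norm\<close>)
  have ev: "\<forall>\<^sub>F n in sequentially. (\<lambda>x. if \<bar>x\<bar> \<le> int n then f x else 0) = f"
    using eventually_ge_at_top[of "nat (\<Sum>y\<in>S. \<bar>y\<bar>)"]
  proof eventually_elim
    case (elim n)
    have "\<bar>x\<bar> \<le> int n" if "x \<in> S" for x
      using member_le_sum[of x S "\<lambda>x. \<bar>x\<bar>"] S(1) that elim by auto
    then show ?case using S(2) by (auto simp: fun_eq_iff)
  qed
  have lim: "(\<lambda>n. LINT \<xi>|torus. (cmod (fourier_Z_l1 (\<lambda>x. if \<bar>x\<bar> \<le> int n then f x else 0) \<xi> - g \<xi>))\<^sup>2)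
      \<longlonglongrightarrow> (LINT \<xi>|torus. (cmod (F \<xi> - g \<xi>))\<^sup>2)" for g
    by (rule tendsto_eventually) (use ev in eventually_elim, simp add: Fl1)
  have "is_fourier_Z f F"
    unfolding is_fourier_Z_def L2_torus_def using lim[of F] meas F2 by simp
  then have isF: "is_fourier_Z f (fourier_Z f)" unfolding fourier_Z_def by (rule someI[of "is_fourier_Z f"])
  define g where "g = fourier_Z f"
  have g: "g \<in> borel_measurable torus" "integrable torus (\<lambda>\<xi>. (cmod (g \<xi>))\<^sup>2)"
    using isF unfolding is_fourier_Z_def L2_torus_def g_def by auto
  have zero: "(LINT \<xi>|torus. (cmod (F \<xi> - g \<xi>))\<^sup>2) = 0"
    using isF lim[of g] unfolding is_fourier_Z_def g_def by (blast intro: LIMSEQ_unique)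
  \<comment> \<open>A Bochner integral is 0 also for non-integrable functions, so integrability must
    be known before concluding that the integrand vanishes almost everywhere.\<close>
  have int: "integrable torus (\<lambda>\<xi>. (cmod (F \<xi> - g \<xi>))\<^sup>2)"
  proof (rule Bochner_Integration.integrable_bound)
    show "integrable torus (\<lambda>\<xi>. 2 * (cmod (F \<xi>))\<^sup>2 + 2 * (cmod (g \<xi>))\<^sup>2)"
      using F2 g(2) by simp
    show "(\<lambda>\<xi>. (cmod (F \<xi> - g \<xi>))\<^sup>2) \<in> borel_measurable torus"
      using meas g(1) by measurable
    show "AE \<xi> in torus. norm ((cmod (F \<xi> - g \<xi>))\<^sup>2) \<le> norm (2 * (cmod (F \<xi>))\<^sup>2 + 2 * (cmod (g \<xi>))\<^sup>2)"
    proof (rule AE_I2)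
      fix \<xi>
      have "(cmod (F \<xi> - g \<xi>))\<^sup>2 \<le> (cmod (F \<xi>) + cmod (g \<xi>))\<^sup>2"
        by (intro power_mono norm_triangle_ineq4) simp
      also have "\<dots> \<le> 2 * (cmod (F \<xi>))\<^sup>2 + 2 * (cmod (g \<xi>))\<^sup>2"
        using sum_squares_bound[of "cmod (F \<xi>)" "cmod (g \<xi>)"] by (simp add: power2_sum)
      finally show "norm ((cmod (F \<xi> - g \<xi>))\<^sup>2) \<le> norm (2 * (cmod (F \<xi>))\<^sup>2 + 2 * (cmod (g \<xi>))\<^sup>2)"
        by simp
    qed
  qed
  have "AE \<xi> in torus. (cmod (F \<xi> - g \<xi>))\<^sup>2 = 0"
    using integral_nonneg_eq_0_iff_AE[OF int] zero by simp
  then show "AE \<xi> in torus. fourier_Z f \<xi> = (\<Sum>y\<in>S. f y * e_char (- (of_int y * \<xi>)))"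
    unfolding g_def F_def by eventually_elim simp
  show "fourier_Z f \<in> borel_measurable torus" using g(1) by (simp add: g_def)
qed

text \<open>From here on the operator is a concrete convolution, and the arbitrary choice of a
  representative in \<open>fourier_Z\<close> has disappeared.\<close>

lemma multiplier_op_finite:
  fixes f :: "int \<Rightarrow> complex"
  assumes S: "finite S" "\<And>y. y \<notin> S \<Longrightarrow> f y = 0"
    and meas: "M \<in> borel_measurable torus" and bd: "\<And>\<xi>. norm (M \<xi>) \<le> B"
  shows "multiplier_op M f x = (\<Sum>y\<in>S. f y * fourier_Z_inv M (x - y))"
proof -
  have e: "(\<lambda>\<xi>. e_char (of_int n * \<xi>)) \<in> borel_measurable torus" for n :: int
    by (rule borel_measurable_torusI) measurable
  have intM: "integrable torus (\<lambda>\<xi>. M \<xi> * e_char (of_int n * \<xi>))" for n :: int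
    by (rule integrable_torus_bounded[of _ B])
      (use meas e bd in \<open>auto simp: norm_mult intro: borel_measurable_times\<close>)
  have fz: "fourier_Z f \<in> borel_measurable torus"
    "AE \<xi> in torus. fourier_Z f \<xi> = (\<Sum>y\<in>S. f y * e_char (- (of_int y * \<xi>)))"
    by (rule fourier_Z_finite_AE[OF S(1)], simp add: S(2))+
  have "multiplier_op M f x = (LINT \<xi>|torus. M \<xi> * fourier_Z f \<xi> * e_char (of_int x * \<xi>))"
    by (simp add: multiplier_op_def fourier_Z_inv_def)
  also have "\<dots> = (LINT \<xi>|torus. (\<Sum>y\<in>S. f y * (M \<xi> * e_char (of_int (x - y) * \<xi>))))"
  proof (rule integral_cong_AE)
    show "(\<lambda>\<xi>. M \<xi> * fourier_Z f \<xi> * e_char (of_int x * \<xi>)) \<in> borel_measurable torus"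
      using meas e fz(1) by (intro borel_measurable_times)
    show "(\<lambda>\<xi>. \<Sum>y\<in>S. f y * (M \<xi> * e_char (of_int (x - y) * \<xi>))) \<in> borel_measurable torus"
      using meas by (intro borel_measurable_sum borel_measurable_times borel_measurable_const e)
    show "AE \<xi> in torus. M \<xi> * fourier_Z f \<xi> * e_char (of_int x * \<xi>)
        = (\<Sum>y\<in>S. f y * (M \<xi> * e_char (of_int (x - y) * \<xi>)))"
      using fz(2)
    proof eventually_elim
      case (elim \<xi>)
      have "e_char (of_int (x - y) * \<xi>) = e_char (- (of_int y * \<xi>)) * e_char (of_int x * \<xi>)" for y
        unfolding e_char_add[symmetric] by (rule arg_cong[of _ _ e_char]) (simp add: algebra_simps)
      then show ?case unfolding elim by (simp only: sum_distrib_left sum_distrib_right mult_ac)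
    qed
  qed
  also have "\<dots> = (\<Sum>y\<in>S. f y * fourier_Z_inv M (x - y))"
    unfolding fourier_Z_inv_def using intM
    by (subst Bochner_Integration.integral_sum) (auto simp del: of_int_diff)
  finally show ?thesis .
qed

text \<open>Bridges the Lebesgue integral over the half-open domain and the gauge integral over the
  closed interval, where integration by parts is available.\<close>

lemma fourier_Z_inv_eq_integral:
  assumes "continuous_on UNIV g" "\<And>\<xi>. \<xi> \<in> {-1/2..<1/2} \<Longrightarrow> M \<xi> = g \<xi>"
  shows "fourier_Z_inv M n = integral {-1/2..1/2} (\<lambda>\<xi>. g \<xi> * e_char (of_int n * \<xi>))"
proof -
  let ?g = "\<lambda>\<xi>. g \<xi> * e_char (of_int n * \<xi>)"
  have cont: "continuous_on A ?g" for A
    by (intro continuous_intros continuous_on_subset[OF assms(1)]) auto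
  have "fourier_Z_inv M n = (LINT \<xi>|torus. ?g \<xi>)"
    unfolding fourier_Z_inv_def
    by (rule Bochner_Integration.integral_cong) (use assms(2) in \<open>auto simp: torus_def space_restrict_space\<close>)
  also have "\<dots> = set_lebesgue_integral lborel {-1/2..<1/2} ?g"
    unfolding torus_def set_lebesgue_integral_def by (rule integral_restrict_space) simp
  also have "\<dots> = integral {-1/2..<1/2} ?g"
  proof (rule set_borel_integral_eq_integral(2))
    have "set_integrable lborel {-1/2..1/2} ?g"
      unfolding set_integrable_def by (rule borel_integrable_compact) (use cont in auto)
    then show "set_integrable lborel {-1/2..<1/2} ?g"
      by (rule set_integrable_subset) auto
  qed
  also have "\<dots> = integral {-1/2..1/2} ?g"
    by (rule integral_spike_set) (auto intro: negligible_subset[of "{1/2}"])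
  finally show ?thesis .
qed

section \<open>From the operator norm to inequalities between finite sums\<close>

lemma lp_norm_finite_support:
  assumes "finite S" "\<And>y. y \<notin> S \<Longrightarrow> f y = 0"
  shows "lp_norm p f = ennreal ((\<Sum>y\<in>S. cmod (f y) powr p) powr (1 / p))"
proof -
  have "(\<lambda>x. cmod (f x) powr p) summable_on S" using assms(1) by simp
  then have "(\<lambda>x. cmod (f x) powr p) summable_on UNIV"
    by (rule summable_on_cong_neutral[THEN iffD1, rotated -1]) (use assms(2) in auto)
  moreover have "(\<Sum>\<^sub>\<infinity>x. cmod (f x) powr p) = infsum (\<lambda>x. cmod (f x) powr p) S"
    by (rule infsum_cong_neutral) (use assms(2) in auto)
  ultimately show ?thesis using assms(1) by (simp add: lp_norm_def)
qed

text \<open>Normalized to unit norm, f is admissible in the supremum, its l^2 norm being finite by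
  finite support; the convolution formula supplies the homogeneity that undoes the
  normalization.\<close>

lemma lp_op_norm_finite_bound:
  fixes f :: "int \<Rightarrow> complex" and K :: "int \<Rightarrow> complex"
  assumes T: "\<And>f S x. finite S \<Longrightarrow> (\<And>y. y \<notin> S \<Longrightarrow> f y = 0) \<Longrightarrow> T f x = (\<Sum>y\<in>S. f y * K (x - y))"
    and op: "lp_op_norm p T \<le> ennreal b" and "b \<ge> 0" "p > 0"
    and S: "finite S" "\<And>y. y \<notin> S \<Longrightarrow> f y = 0" and X: "finite X"
  shows "(\<Sum>x\<in>X. cmod (T f x) powr p) \<le> b powr p * (\<Sum>y\<in>S. cmod (f y) powr p)"
proof -
  define s where "s = (\<Sum>y\<in>S. cmod (f y) powr p)"
  have s0: "s \<ge> 0" unfolding s_def by (rule sum_nonneg) auto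
  show ?thesis
  proof (cases "s = 0")
    case True
    then have "f y = 0" for y
      using S \<open>p > 0\<close> sum_nonneg_eq_0_iff[OF S(1), of "\<lambda>y. cmod (f y) powr p"]
      unfolding s_def by (cases "y \<in> S") auto
    then have "T f x = 0" for x by (subst T[OF S]) auto
    then show ?thesis using s0 \<open>p > 0\<close> by (simp add: s_def[symmetric])
  next
    case False
    then have spos: "s > 0" using s0 by simp
    define c where "c = s powr (1 / p)"
    have c: "c > 0" "c powr p = s" using spos \<open>p > 0\<close> by (auto simp: c_def powr_powr)
    define g where "g y = f y / of_real c" for y
    have gS: "g y = 0" if "y \<notin> S" for y using S(2)[OF that] by (simp add: g_def)
    have lp: "lp_norm q g = ennreal ((\<Sum>y\<in>S. cmod (g y) powr q) powr (1 / q))" for q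
      by (rule lp_norm_finite_support[OF S(1)]) (simp add: gS)
    have "(\<Sum>y\<in>S. cmod (g y) powr p) = s / s"
      unfolding g_def using c by (simp add: norm_divide powr_divide flip: sum_divide_distrib s_def)
    then have "lp_norm p g = 1" using lp spos by simp
    moreover have "lp_norm 2 g < \<infinity>" using lp by simp
    ultimately have "lp_norm p (T g) \<le> lp_op_norm p T"
      unfolding lp_op_norm_def by (intro SUP_upper) auto
    then have le: "lp_norm p (T g) \<le> ennreal b" using op by (rule order_trans)
    define A where "A = (\<Sum>\<^sub>\<infinity>x. cmod (T g x) powr p)"
    \<comment> \<open>\<open>lp_norm\<close> is infinite for divergent sums, so a finite bound
      forces summability.\<close>
    have sm: "(\<lambda>x. cmod (T g x) powr p) summable_on UNIV"
      using le by (auto simp: lp_norm_def top_unique split: if_splits)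
    have A0: "A \<ge> 0" unfolding A_def by (rule infsum_nonneg) auto
    have "A powr (1 / p) \<le> b"
      using le sm \<open>b \<ge> 0\<close> by (simp add: lp_norm_def A_def[symmetric] ennreal_le_iff)
    then have "(A powr (1 / p)) powr p \<le> b powr p"
      using \<open>p > 0\<close> by (intro powr_mono2) auto
    then have Ab: "A \<le> b powr p" using A0 \<open>p > 0\<close> by (simp add: powr_powr)
    have Tg: "T g x = T f x / of_real c" for x
    proof -
      have "T f x = (\<Sum>y\<in>S. f y * K (x - y))" by (rule T[OF S(1)]) (simp add: S(2))
      moreover have "T g x = (\<Sum>y\<in>S. g y * K (x - y))" by (rule T[OF S(1)]) (simp add: gS)
      ultimately show ?thesis by (simp add: g_def sum_divide_distrib)
    qed
    have "(\<Sum>x\<in>X. cmod (T f x) powr p) / s = (\<Sum>x\<in>X. cmod (T g x) powr p)"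
      unfolding Tg using c by (simp add: norm_divide powr_divide sum_divide_distrib)
    also have "\<dots> \<le> A"
      unfolding A_def by (rule finite_sum_le_infsum) (use sm X in auto)
    finally have "(\<Sum>x\<in>X. cmod (T f x) powr p) / s \<le> b powr p" using Ab by linarith
    then show ?thesis using spos by (simp add: field_simps s_def)
  qed
qed

section \<open>Transference to periodic functions\<close>

lemma sum_over_periods:
  fixes g :: "int \<Rightarrow> real" and Q :: nat
  assumes "\<And>x. g (x mod int Q) = g x"
  shows "(\<Sum>x\<in>{a * int Q..<(a + int J) * int Q}. g x) = real J * (\<Sum>x\<in>{0..<int Q}. g x)"
proof (induction J)
  case 0
  then show ?case by simp
next
  case (Suc J)
  let ?k = "a + int J"
  have shift: "g (x + ?k * int Q) = g x" for x
    using assms[of x] assms[of "x + ?k * int Q"] by simp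
  have "(\<Sum>x\<in>{?k * int Q..<(?k + 1) * int Q}. g x) = (\<Sum>x\<in>{0..<int Q}. g x)"
    by (rule sum.reindex_bij_witness[of _ "\<lambda>x. x + ?k * int Q" "\<lambda>x. x - ?k * int Q"])
      (use shift in \<open>auto simp: algebra_simps\<close>, use shift[of "_ - ?k * int Q"] in \<open>auto simp: algebra_simps\<close>)
  moreover have "{a * int Q..<(a + int (Suc J)) * int Q}
      = {a * int Q..<?k * int Q} \<union> {?k * int Q..<(?k + 1) * int Q}"
  proof -
    have "a * int Q \<le> ?k * int Q" "?k * int Q \<le> (?k + 1) * int Q" by (intro mult_right_mono; simp)+
    moreover have "a + int (Suc J) = ?k + 1" by simp
    ultimately show ?thesis by (simp only: ivl_disj_un)
  qed
  moreover have "{a * int Q..<?k * int Q} \<inter> {?k * int Q..<(?k + 1) * int Q} = {}" by auto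
  ultimately show ?case using Suc by (simp add: sum.union_disjoint algebra_simps)
qed

text \<open>Truncating a \<open>Q\<close>-periodic \<open>F\<close> to \<open>J + 2 M\<close> periods changes the convolution on the inner
  \<open>J\<close> periods only by the tail of \<open>K\<close> beyond \<open>M\<close>; take \<open>J = M\<^sup>2\<close> and let \<open>M\<close> tend to infinity.\<close>
lemma periodic_transference:
  fixes K F A :: "int \<Rightarrow> complex" and Q :: nat and b p :: real
  assumes "Q > 0" "b \<ge> 0" "p > 0"
    and K: "(\<lambda>n. norm (K n)) summable_on UNIV"
    and per: "\<And>x. F (x mod int Q) = F x"
    and A: "\<And>x. ((\<lambda>n. K n * F (x - n)) has_sum A x) UNIV"
    and bound: "\<And>S X f. finite S \<Longrightarrow> finite X \<Longrightarrow> (\<And>y. y \<notin> S \<Longrightarrow> f y = 0) \<Longrightarrow>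
      (\<Sum>x\<in>X. cmod (\<Sum>y\<in>S. f y * K (x - y)) powr p) \<le> b powr p * (\<Sum>y\<in>S. cmod (f y) powr p)"
  shows "(\<Sum>x\<in>{0..<int Q}. cmod (A x) powr p) \<le> b powr p * (\<Sum>x\<in>{0..<int Q}. cmod (F x) powr p)"
proof -
  define Fm where "Fm = (\<Sum>x\<in>{0..<int Q}. cmod (F x))"
  have Fm: "cmod (F x) \<le> Fm" for x
  proof -
    have "cmod (F (x mod int Q)) \<le> Fm"
      unfolding Fm_def using \<open>Q > 0\<close> by (intro member_le_sum) auto
    then show ?thesis by (simp add: per)
  qed
  have Fm0: "Fm \<ge> 0" using order_trans[OF norm_ge_zero Fm] .
  define tail where "tail m = infsum (\<lambda>n. norm (K n)) (UNIV - {- int m..int m})" for m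
  define \<delta> where "\<delta> m = Fm * tail m" for m
  have "(\<lambda>m. infsum (\<lambda>n. norm (K n)) UNIV - sum (\<lambda>n. norm (K n)) {- int m..int m}) \<longlonglongrightarrow>
      infsum (\<lambda>n. norm (K n)) UNIV - infsum (\<lambda>n. norm (K n)) UNIV"
  proof (intro tendsto_intros)
    have "(sum (\<lambda>n. norm (K n)) \<longlongrightarrow> infsum (\<lambda>n. norm (K n)) UNIV) (finite_subsets_at_top UNIV)"
      using has_sum_infsum[OF K] by (simp add: has_sum_def)
    then show "(\<lambda>m. sum (\<lambda>n. norm (K n)) {- int m..int m}) \<longlonglongrightarrow> infsum (\<lambda>n. norm (K n)) UNIV"
      by (rule filterlim_compose[OF _ filterlim_symmetric_int_intervals])
  qed
  then have tail: "tail \<longlonglongrightarrow> 0"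
    unfolding tail_def by (subst infsum_Diff) (use K in auto)
  have \<delta>: "\<delta> \<longlonglongrightarrow> 0"
    unfolding \<delta>_def using tendsto_mult_right_zero[OF tail] by simp
  have Aper: "A (x mod int Q) = A x" for x
  proof -
    have "F (x mod int Q - n) = F (x - n)" for n
      using per[of "x mod int Q - n"] per[of "x - n"] by (simp add: mod_simps)
    then show ?thesis using A[of "x mod int Q"] A[of x] by (simp add: has_sum_unique)
  qed
  have approx: "cmod (A x - (\<Sum>y\<in>S. F y * K (x - y))) \<le> \<delta> m"
    if S: "finite S" and far: "\<And>y. y \<notin> S \<Longrightarrow> x - y \<notin> {- int m..int m}" for S x m
  proof -
    let ?W = "(\<lambda>y. x - y) ` S"
    let ?g = "\<lambda>n. K n * F (x - n)"
    have gn: "(\<lambda>n. norm (?g n)) summable_on B" for B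
    proof -
      have "(\<lambda>n. norm (?g n)) summable_on UNIV"
        by (rule Infinite_Sum.abs_summable_on_comparison_test'[OF summable_on_cmult_left[OF K, of Fm]])
          (use Fm in \<open>auto simp: norm_mult intro: mult_left_mono\<close>)
      then show ?thesis by (rule summable_on_subset_banach) simp
    qed
    have KB: "(\<lambda>n. norm (K n)) summable_on B" for B
      using K by (rule summable_on_subset_banach) simp
    have "(\<Sum>y\<in>S. F y * K (x - y)) = sum ?g ?W"
      by (subst sum.reindex) (auto simp: inj_on_def mult.commute)
    moreover have "infsum ?g (UNIV - ?W) = infsum ?g UNIV - infsum ?g ?W"
      by (rule infsum_Diff) (use gn S in \<open>auto intro: abs_summable_summable\<close>)
    moreover have "infsum ?g UNIV = A x" using A by (rule infsumI)
    ultimately have "A x - (\<Sum>y\<in>S. F y * K (x - y)) = infsum ?g (UNIV - ?W)"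
      using S by simp
    also have "norm \<dots> \<le> infsum (\<lambda>n. norm (?g n)) (UNIV - ?W)"
      by (rule norm_infsum_bound) (rule gn)
    also have "\<dots> \<le> infsum (\<lambda>n. Fm * norm (K n)) (UNIV - {- int m..int m})"
    proof (rule infsum_mono_neutral)
      show "(\<lambda>n. Fm * norm (K n)) summable_on (UNIV - {- int m..int m})"
        by (intro summable_on_cmult_right KB)
      fix n assume "n \<in> (UNIV - ?W) \<inter> (UNIV - {- int m..int m})"
      show "norm (?g n) \<le> Fm * norm (K n)"
        using mult_right_mono[OF Fm norm_ge_zero] by (simp add: norm_mult mult.commute)
    next
      fix n assume n: "n \<in> (UNIV - ?W) - (UNIV - {- int m..int m})"
      then have "x - n \<notin> S" by (metis DiffD1 DiffD2 diff_diff_eq2 add_diff_cancel_left' image_eqI)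
      then have False using far[of "x - n"] n by auto
      then show "norm (?g n) \<le> 0" ..
    qed (use gn Fm0 in auto)
    also have "\<dots> = \<delta> m" unfolding \<delta>_def tail_def by (rule infsum_cmult_right) (use KB in auto)
    finally show ?thesis .
  qed
  define cF where "cF = (\<Sum>x\<in>{0..<int Q}. cmod (F x) powr p)"
  \<comment> \<open>The maximum with 0 keeps the base nonnegative when \<open>\<delta> m\<close>
    exceeds \<open>cmod (A x)\<close>, as monotonicity of \<open>powr\<close> requires.\<close>
  have main: "(\<Sum>x\<in>{0..<int Q}. (max 0 (cmod (A x) - \<delta> m)) powr p) \<le> b powr p * ((1 + 2 / real m) * cF)"
    if m: "m \<ge> 1" for m
  proof -
    define J where "J = m\<^sup>2"
    let ?S = "{- int m * int Q..<(- int m + int (J + 2 * m)) * int Q}"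
    let ?X = "{0 * int Q..<(0 + int J) * int Q}"
    define f where "f y = (if y \<in> ?S then F y else 0)" for y
    \<comment> \<open>The margin of m whole periods on either side is at least m integers wide
      because \<open>Q >= 1\<close>.\<close>
    have far: "x - y \<notin> {- int m..int m}" if "x \<in> ?X" "y \<notin> ?S" for x y
    proof -
      have "int m * 1 \<le> int m * int Q" using \<open>Q > 0\<close> by (intro mult_left_mono) auto
      moreover have "y < - (int m * int Q) \<or> y \<ge> int J * int Q + int m * int Q"
        using that(2) by (auto simp: algebra_simps)
      moreover have "0 \<le> x" "x < int J * int Q" using that(1) by auto
      ultimately show ?thesis by auto
    qed
    have "real J * (\<Sum>x\<in>{0..<int Q}. (max 0 (cmod (A x) - \<delta> m)) powr p)
        = (\<Sum>x\<in>?X. (max 0 (cmod (A x) - \<delta> m)) powr p)"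
      by (rule sum_over_periods[symmetric]) (simp add: Aper)
    also have "\<dots> \<le> (\<Sum>x\<in>?X. cmod (\<Sum>y\<in>?S. f y * K (x - y)) powr p)"
    proof (intro sum_mono powr_mono2)
      fix x assume x: "x \<in> ?X"
      have "(\<Sum>y\<in>?S. f y * K (x - y)) = (\<Sum>y\<in>?S. F y * K (x - y))"
        by (rule sum.cong) (auto simp: f_def)
      then have "cmod (A x - (\<Sum>y\<in>?S. f y * K (x - y))) \<le> \<delta> m"
        using approx[of ?S x m] far[OF x] by simp
      then show "max 0 (cmod (A x) - \<delta> m) \<le> cmod (\<Sum>y\<in>?S. f y * K (x - y))"
        using norm_triangle_ineq2[of "A x" "\<Sum>y\<in>?S. f y * K (x - y)"] by simp
    qed (use \<open>p > 0\<close> in auto)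
    also have "\<dots> \<le> b powr p * (\<Sum>y\<in>?S. cmod (f y) powr p)"
      by (rule bound) (auto simp: f_def)
    also have "(\<Sum>y\<in>?S. cmod (f y) powr p) = (\<Sum>y\<in>?S. cmod (F y) powr p)"
      by (rule sum.cong) (auto simp: f_def)
    also have "\<dots> = real (J + 2 * m) * cF"
      unfolding cF_def by (rule sum_over_periods) (simp add: per)
    also have "real (J + 2 * m) = real J * (1 + 2 / real m)"
      using m by (simp add: J_def field_simps power2_eq_square)
    finally have "real J * (\<Sum>x\<in>{0..<int Q}. (max 0 (cmod (A x) - \<delta> m)) powr p)
        \<le> real J * (b powr p * ((1 + 2 / real m) * cF))"
      by (simp only: mult_ac)
    then show ?thesis using m by (simp add: J_def)
  qed
  have lim1: "(\<lambda>m. \<Sum>x\<in>{0..<int Q}. (max 0 (cmod (A x) - \<delta> m)) powr p)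
      \<longlonglongrightarrow> (\<Sum>x\<in>{0..<int Q}. (max 0 (cmod (A x) - 0)) powr p)"
    using \<open>p > 0\<close> by (intro tendsto_sum tendsto_powr' tendsto_max tendsto_diff tendsto_const \<delta>) auto
  have "(\<lambda>m. 1 + 2 / real m) \<longlonglongrightarrow> 1" by real_asymp
  then have lim2: "(\<lambda>m. b powr p * ((1 + 2 / real m) * cF)) \<longlonglongrightarrow> b powr p * (1 * cF)"
    by (intro tendsto_intros)
  have "(\<Sum>x\<in>{0..<int Q}. (max 0 (cmod (A x) - 0)) powr p) \<le> b powr p * (1 * cF)"
    by (rule LIMSEQ_le[OF lim1 lim2]) (use main in blast)
  then show ?thesis by (simp add: cF_def)
qed

text \<open>Characters are eigenfunctions of convolution with K. One common eigenvalue
  \<open>v\<close> is enough, because the multiplier is constant on the primitive and on the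
  imprimitive frequencies.\<close>

lemma trig_poly_convolution:
  fixes K :: "int \<Rightarrow> complex"
  assumes "f \<in> trig_poly \<Theta>"
    and "\<And>\<theta>. \<theta> \<in> \<Theta> \<Longrightarrow> ((\<lambda>n. K n * e_char (- (of_int n * \<theta>))) has_sum v) UNIV"
  shows "((\<lambda>n. K n * f (x - n)) has_sum (v * f x)) UNIV"
  using assms(1)
proof induction
  case zero
  then show ?case by simp
next
  case (add_term \<theta> f c)
  have "((\<lambda>n. (c * e_char (of_int x * \<theta>)) * (K n * e_char (- (of_int n * \<theta>))) + K n * f (x - n))
      has_sum ((c * e_char (of_int x * \<theta>)) * v + v * f x)) UNIV"
    by (intro has_sum_add has_sum_cmult_right assms(2) add_term)
  moreover have "e_char (of_int (x - n) * \<theta>) = e_char (of_int x * \<theta>) * e_char (- (of_int n * \<theta>))" for n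
    unfolding e_char_add[symmetric] by (rule arg_cong[of _ _ e_char]) (simp add: algebra_simps)
  ultimately show ?case by (simp only: distrib_left mult_ac)
qed

section \<open>The multiplier at rational frequencies\<close>

lemma torus_rep_add_of_int [simp]: "torus_rep (x + of_int n) = torus_rep x"
proof -
  have "x + of_int n + 1/2 = x + 1/2 + of_int n" by simp
  then show ?thesis unfolding torus_rep_def by (simp only: floor_add_int[symmetric])
qed

lemma torus_rep_eq_minus_of_int: obtains n where "torus_rep x = x - of_int n"
  using torus_rep_def by blast

lemma torus_rep_diff: "torus_rep (torus_rep x - torus_rep y) = torus_rep (x - y)"
proof -
  obtain m n where "torus_rep x = x - of_int m" "torus_rep y = y - of_int n"
    using torus_rep_eq_minus_of_int by metis
  then have "torus_rep x - torus_rep y = x - y + of_int (n - m)" by simp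
  then show ?thesis by (simp only: torus_rep_add_of_int)
qed

lemma torus_rep_eq_0_iff: "torus_rep x = 0 \<longleftrightarrow> x \<in> \<int>"
proof
  assume "x \<in> \<int>"
  then obtain n where "x = 0 + of_int n" by (auto elim: Ints_cases)
  then have "torus_rep x = torus_rep 0" by (simp only: torus_rep_add_of_int)
  then show "torus_rep x = 0" by (simp add: torus_rep_def)
next
  assume "torus_rep x = 0"
  then have "x = of_int \<lfloor>x + 1/2\<rfloor>" by (simp add: torus_rep_def)
  then show "x \<in> \<int>" by (metis Ints_of_int)
qed

lemma torus_rep_eqI:
  assumes "x - y \<in> \<int>" shows "torus_rep x = torus_rep y"
proof -
  obtain n where "x - y = of_int n" using assms by (auto elim: Ints_cases)
  then have "x = y + of_int n" by simp
  then show ?thesis by (simp only: torus_rep_add_of_int)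
qed

text \<open>The reduced difference is a fraction over \<open>Q q\<close> whose numerator is a
  nonzero integer.\<close>

lemma abs_torus_rep_diff_fractions_ge:
  fixes a b :: int and q Q :: nat
  assumes "q > 0" "Q > 0" "of_int b / real Q - of_int a / real q \<notin> \<int>"
  shows "1 / (real Q * real q) \<le> \<bar>torus_rep (of_int b / real Q - of_int a / real q)\<bar>"
proof -
  let ?x = "of_int b / real Q - of_int a / real q"
  obtain k where k: "torus_rep ?x = ?x - of_int k" by (rule torus_rep_eq_minus_of_int)
  define m where "m = b * int q - a * int Q - k * int Q * int q"
  have eq: "torus_rep ?x = of_int m / (real Q * real q)"
    unfolding k m_def using assms(1,2) by (simp add: field_simps)
  have "m \<noteq> 0"
    using assms(3) unfolding torus_rep_eq_0_iff[symmetric] eq by auto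
  then have "1 \<le> \<bar>real_of_int m\<bar>" by linarith
  then show ?thesis unfolding eq using assms(1,2) by (simp add: divide_right_mono)
qed

text \<open>With \<open>N = Q - 1\<close>, the only fractions \<open>b / Q\<close> missed by the canonical fractions are the
  primitive ones, and the gap \<open>1 / (Q N) \<ge> 1 / (2 N\<^sup>2) \<ge> \<epsilon> / 2\<close> keeps those out of the support.\<close>
lemma Delta_at_fraction:
  fixes \<mm> :: "real \<Rightarrow> complex" and b :: int and Q N :: nat
  assumes Q: "Q = Suc N" "N \<ge> 1" and \<epsilon>: "0 < \<epsilon>" "\<epsilon> \<le> 1 / (real N)\<^sup>2"
    and supp: "\<And>x. \<bar>x\<bar> \<ge> 1/2 \<Longrightarrow> \<mm> x = 0" and one: "\<mm> 0 = 1"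
  shows "Delta \<epsilon> (canonical_fractions N) \<mm> (torus_rep (of_int b / real Q))
    = (if coprime b (int Q) then 0 else 1)"
proof -
  let ?\<theta> = "torus_rep (of_int b / real Q)"
  have N0: "real N > 0" using Q by simp
  \<comment> \<open>The bound \<open>2 * N * N\<close> serves both cases below: it covers
    \<open>Q q\<close> through \<open>Q = N + 1 <= 2 N\<close>, and \<open>k q\<close> with
    \<open>k <= N\<close>.\<close>
  have vanish: "\<mm> (inverse \<epsilon> * s) = 0" if "\<bar>s\<bar> \<ge> 1 / (real k * real q)" "k > 0" "q > 0" "k * q \<le> 2 * N * N"
    for s :: real and k q :: nat
  proof (rule supp)
    have "real k * real q \<le> 2 * (real N)\<^sup>2"
      using that(4) by (metis of_nat_le_iff of_nat_mult of_nat_numeral power2_eq_square mult.assoc)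
    then have "1 / (2 * (real N)\<^sup>2) \<le> 1 / (real k * real q)"
      using that(2,3) N0 by (intro divide_left_mono) auto
    then have "\<epsilon> / 2 \<le> \<bar>s\<bar>" using that(1) \<epsilon>(2) by simp
    then show "1/2 \<le> \<bar>inverse \<epsilon> * s\<bar>" using \<epsilon>(1) by (simp add: abs_mult field_simps)
  qed
  show ?thesis
  proof (cases "coprime b (int Q)")
    case True
    have "\<mm> (inverse \<epsilon> * torus_rep (?\<theta> - r)) = 0" if "r \<in> canonical_fractions N" for r
    proof -
      obtain a q where r: "r = torus_rep (of_int a / real q)" "q \<in> {1..N}" "coprime a (int q)"
        using \<open>r \<in> _\<close> unfolding canonical_fractions_def by auto
      have "of_int b / real Q - of_int a / real q \<notin> \<int>"
      proof
        assume "of_int b / real Q - of_int a / real q \<in> \<int>"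
        then obtain k where "of_int b / real Q - of_int a / real q = of_int k" by (auto elim: Ints_cases)
        then have "real_of_int (b * int q) = of_int (int Q * (a + k * int q))"
          using r(2) Q by (simp add: field_simps)
        then have "b * int q = int Q * (a + k * int q)" by (simp only: of_int_eq_iff)
        then have "int Q dvd b * int q" by simp
        then have "int Q dvd int q"
          using True by (simp add: coprime_commute coprime_dvd_mult_right_iff)
        then show False using r(2) Q by (auto dest: zdvd_imp_le)
      qed
      then have "1 / (real Q * real q) \<le> \<bar>torus_rep (?\<theta> - r)\<bar>"
        unfolding r(1) torus_rep_diff using r(2) Q by (intro abs_torus_rep_diff_fractions_ge) auto
      moreover have "Q * q \<le> 2 * N * N"
        using r(2) Q by (intro mult_mono) auto
      ultimately show ?thesis using r(2) Q by (intro vanish) auto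
    qed
    then show ?thesis using True by (simp add: Delta_def)
  next
    case False
    \<comment> \<open>The common factor is at least 2, so the reduced denominator is at most
      \<open>Q / 2\<close>, hence at most N: the point is itself a canonical fraction, and its own
      term \<open>\<mm> 0 = 1\<close> is the only one left.\<close>
    define g where "g = nat (gcd b (int Q))"
    define b' where "b' = b div int g"
    define k where "k = Q div g"
    have g: "g dvd Q" "int g dvd b"
      unfolding g_def by (auto simp: nat_dvd_iff)
    have gi: "int g = gcd b (int Q)" unfolding g_def by simp
    have "gcd b (int Q) \<noteq> 1" using False coprime_iff_gcd_eq_1 by blast
    moreover have "gcd b (int Q) > 0" using Q by simp
    ultimately have g2: "g \<ge> 2" using gi by linarith
    have kQ: "Q = k * g" and bg: "b = b' * int g" using g by (auto simp: k_def b'_def)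
    have k0: "k > 0" using kQ Q by (cases k) auto
    have "2 * k \<le> Q" unfolding kQ using g2 by (simp add: mult.commute)
    then have kN: "k \<le> N" using Q by linarith
    have eq: "of_int b / real Q = of_int b' / real k"
      unfolding kQ bg using g2 k0 by (simp add: field_simps)
    have "coprime b' (int k)"
    proof -
      have "coprime (b div gcd b (int Q)) (int Q div gcd b (int Q))"
        by (rule div_gcd_coprime) (use Q in auto)
      then show ?thesis by (simp add: b'_def k_def gi[symmetric] zdiv_int)
    qed
    then have mem: "?\<theta> \<in> canonical_fractions N"
      unfolding canonical_fractions_def eq using k0 kN
      by (intro CollectI exI[of _ b'] exI[of _ k] conjI) auto
    have "\<mm> (inverse \<epsilon> * torus_rep (?\<theta> - r)) = 0" if "r \<in> canonical_fractions N - {?\<theta>}" for r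
    proof -
      obtain a q where r: "r = torus_rep (of_int a / real q)" "q \<in> {1..N}" "coprime a (int q)"
        using \<open>r \<in> _\<close> unfolding canonical_fractions_def by auto
      have "of_int b' / real k - of_int a / real q \<notin> \<int>"
        using torus_rep_eqI[of "of_int b' / real k" "of_int a / real q"] that r(1) eq by auto
      then have "1 / (real k * real q) \<le> \<bar>torus_rep (?\<theta> - r)\<bar>"
        unfolding r(1) eq torus_rep_diff using r(2) k0 by (intro abs_torus_rep_diff_fractions_ge) auto
      moreover have "k * q \<le> 2 * N * N"
        using r(2) kN by (intro mult_mono) auto
      ultimately show ?thesis using r(2) k0 by (intro vanish) auto
    qed
    moreover have "torus_rep 0 = 0" by (simp add: torus_rep_eq_0_iff)
    ultimately have "Delta \<epsilon> (canonical_fractions N) \<mm> ?\<theta> = 1"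
      unfolding Delta_def using sum.remove[OF finite_canonical_fractions mem, of "\<lambda>r. \<mm> (inverse \<epsilon> * torus_rep (?\<theta> - r))"] one
      by simp
    then show ?thesis using False by simp
  qed
qed

section \<open>Smoothness and periodization of the multiplier\<close>

lemma schwartz_nth_deriv:
  assumes "schwartz \<mm>"
  shows "(nth_deriv k \<mm> has_vector_derivative nth_deriv (Suc k) \<mm> x) (at x)"
  using assms unfolding schwartz_def
  by (simp add: nth_deriv_def flip: vector_derivative_works)

lemma nth_deriv_0: "nth_deriv 0 f = f"
  by (simp add: nth_deriv_def)

lemma vector_derivative_zero_outside:
  fixes f :: "real \<Rightarrow> complex"
  assumes "\<And>x. (f has_vector_derivative f' x) (at x)" "\<And>x. \<bar>x\<bar> > r \<Longrightarrow> f x = 0" "\<bar>x\<bar> > r"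
  shows "f' x = 0"
proof -
  have "open {y. \<bar>y\<bar> > r}" by (intro open_Collect_less continuous_intros)
  then have "((\<lambda>_. 0) has_vector_derivative f' x) (at x)"
    using has_vector_derivative_transform_within_open[OF assms(1), of "{y. \<bar>y\<bar> > r}" x "\<lambda>_. 0"] assms(2,3)
    by auto
  then show ?thesis using vector_derivative_unique_at has_vector_derivative_const by blast
qed

text \<open>A smooth replacement for \<open>Delta\<close>, in which \<open>torus_rep\<close> has
  jumps. Two points of the fundamental domain differ by less than 1, so the shifts -1, 0, 1 contain
  every reduction that occurs.\<close>

definition periodized :: "real \<Rightarrow> real set \<Rightarrow> (real \<Rightarrow> complex) \<Rightarrow> real \<Rightarrow> complex" where
  "periodized \<epsilon> R g \<xi> = (\<Sum>r\<in>R. \<Sum>j\<in>{-1,0,1::int}. g (inverse \<epsilon> * (\<xi> - r - of_int j)))"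

lemma periodized_has_vector_derivative:
  assumes "\<And>x. (g has_vector_derivative g' x) (at x)"
  shows "(periodized \<epsilon> R g has_vector_derivative of_real (inverse \<epsilon>) * periodized \<epsilon> R g' \<xi>) (at \<xi>)"
proof -
  have 1: "((\<lambda>\<xi>. g (inverse \<epsilon> * (\<xi> - r - of_int j))) has_vector_derivative
      of_real (inverse \<epsilon>) * g' (inverse \<epsilon> * (\<xi> - r - of_int j))) (at \<xi>)" for r j
  proof -
    have "((\<lambda>\<xi>. inverse \<epsilon> * (\<xi> - r - of_int j)) has_vector_derivative inverse \<epsilon>) (at \<xi>)"
      by (auto intro!: derivative_eq_intros)
    from vector_diff_chain_at[OF this assms] show ?thesis
      by (simp add: o_def scaleR_conv_of_real)
  qed
  show ?thesis
    unfolding periodized_def sum_distrib_left by (intro derivative_intros 1)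
qed

lemma periodized_continuous:
  assumes "continuous_on UNIV g"
  shows "continuous_on A (periodized \<epsilon> R g)"
  unfolding periodized_def
  by (intro continuous_intros continuous_on_compose2[OF assms]) auto

text \<open>With \<open>t = 1/2 - r\<close> in \<open>(0, 1]\<close>, the right endpoint produces
  the shifts \<open>t + 1, t, t - 1\<close> and the left one \<open>t, t - 1, t - 2\<close>. The
  unmatched \<open>t + 1\<close> and \<open>t - 2\<close> have modulus at least 1 and lie outside
  the scaled support.\<close>

lemma periodized_endpoints:
  assumes "R \<subseteq> {-1/2..<1/2}" "\<And>x. \<bar>x\<bar> > 1/2 \<Longrightarrow> g x = 0" "0 < \<epsilon>" "\<epsilon> \<le> 1"
  shows "periodized \<epsilon> R g (1/2) = periodized \<epsilon> R g (-1/2)"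
  unfolding periodized_def
proof (rule sum.cong)
  fix r assume "r \<in> R"
  then have r: "-1/2 \<le> r" "r < 1/2" using assms(1) by auto
  have z: "g (inverse \<epsilon> * x) = 0" if "\<bar>x\<bar> \<ge> 1" for x
  proof (rule assms(2))
    have "1 * 1 \<le> inverse \<epsilon> * \<bar>x\<bar>" using assms(3,4) that by (intro mult_mono) (auto simp: one_le_inverse)
    then show "1/2 < \<bar>inverse \<epsilon> * x\<bar>" using assms(3) by (simp add: abs_mult)
  qed
  define t where "t = 1/2 - r"
  have t: "-1/2 - r = t - 1" by (simp add: t_def)
  have shift: "t - of_int (-1) = t + 1" "t - of_int 0 = t" "t - of_int 1 = t - 1"
    "t - 1 - of_int (-1) = t" "t - 1 - of_int 0 = t - 1" "t - 1 - of_int 1 = t - 2"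
    by simp_all
  have "g (inverse \<epsilon> * (t + 1)) = 0" "g (inverse \<epsilon> * (t - 2)) = 0"
    by (rule z, use r in \<open>simp add: t_def\<close>)+
  moreover have "(\<Sum>j\<in>{-1,0,1::int}. f j) = f (-1) + (f 0 + f 1)" for f :: "int \<Rightarrow> complex"
    by simp
  ultimately show "(\<Sum>j\<in>{-1,0,1::int}. g (inverse \<epsilon> * (1/2 - r - of_int j)))
      = (\<Sum>j\<in>{-1,0,1::int}. g (inverse \<epsilon> * (-1/2 - r - of_int j)))"
    unfolding t t_def[symmetric] by (simp only: shift) simp
qed simp

text \<open>Every shift other than the one made by \<open>torus_rep\<close> leaves a distance of at
  least 1/2, and dividing by \<open>\<epsilon> <= 1\<close> does not decrease it.\<close>

lemma Delta_eq_periodized: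
  assumes "R \<subseteq> {-1/2..<1/2}" "\<And>x. \<bar>x\<bar> \<ge> 1/2 \<Longrightarrow> \<mm> x = 0" "0 < \<epsilon>" "\<epsilon> \<le> 1" "\<xi> \<in> {-1/2..<1/2}"
  shows "Delta \<epsilon> R \<mm> \<xi> = periodized \<epsilon> R \<mm> \<xi>"
  unfolding Delta_def periodized_def
proof (rule sum.cong)
  fix r assume "r \<in> R"
  then have r: "-1/2 \<le> r" "r < 1/2" using assms(1) by auto
  define k where "k = \<lfloor>\<xi> - r + 1/2\<rfloor>"
  have t: "torus_rep (\<xi> - r) = \<xi> - r - of_int k" by (simp add: torus_rep_def k_def)
  have rng: "-1/2 \<le> \<xi> - r - of_int k" "\<xi> - r - of_int k < 1/2"
    using torus_rep_range[of "\<xi> - r"] unfolding t by auto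
  have "-2 < real_of_int k" "real_of_int k < 2" using rng r assms(5) by auto
  then have k: "k \<in> {-1,0,1}" by auto
  have z: "\<mm> (inverse \<epsilon> * (\<xi> - r - of_int j)) = 0" if "j \<noteq> k" for j
  proof (rule assms(2))
    have "\<bar>real_of_int j - of_int k\<bar> \<ge> 1" using that by linarith
    then have "1/2 \<le> \<bar>\<xi> - r - of_int j\<bar>" using rng by linarith
    moreover have "1 * \<bar>\<xi> - r - of_int j\<bar> \<le> inverse \<epsilon> * \<bar>\<xi> - r - of_int j\<bar>"
      using assms(3,4) by (intro mult_right_mono) (auto simp: one_le_inverse)
    ultimately show "1/2 \<le> \<bar>inverse \<epsilon> * (\<xi> - r - of_int j)\<bar>" using assms(3) by (simp add: abs_mult)
  qed
  have "(\<Sum>j\<in>{-1,0,1::int}. \<mm> (inverse \<epsilon> * (\<xi> - r - of_int j)))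
      = (\<Sum>j\<in>{k}. \<mm> (inverse \<epsilon> * (\<xi> - r - of_int j)))"
    by (rule sum.mono_neutral_right) (use k z in auto)
  then show "\<mm> (inverse \<epsilon> * torus_rep (\<xi> - r)) = (\<Sum>j\<in>{-1,0,1::int}. \<mm> (inverse \<epsilon> * (\<xi> - r - of_int j)))"
    by (simp add: t)
qed simp

text \<open>The endpoints are included because the set where f is nonzero is open and so lies in the
  interior. This case matters: the gaps between fractions only give arguments of modulus at least
  1/2.\<close>

lemma continuous_support_vanishes:
  fixes f :: "real \<Rightarrow> complex"
  assumes "continuous_on UNIV f" "closure {x. f x \<noteq> 0} \<subseteq> {-1/2..1/2}" "\<bar>x\<bar> \<ge> 1/2"
  shows "f x = 0"
proof (rule ccontr)
  assume "f x \<noteq> 0"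
  have op: "open {x. f x \<noteq> 0}" using assms(1) by (rule open_Collect_neq) simp
  have "{x. f x \<noteq> 0} \<subseteq> {-1/2..1/2}" by (rule order_trans[OF closure_subset assms(2)])
  then have "{x. f x \<noteq> 0} \<subseteq> interior {-1/2..1/2}" using op by (rule interior_maximal)
  then have "x \<in> {-1/2<..<1/2}" using \<open>f x \<noteq> 0\<close>
    unfolding interior_atLeastAtMost_real by blast
  then show False using assms(3) by auto
qed

lemma canonical_fractions_subset: "canonical_fractions N \<subseteq> {-1/2..<1/2}"
  unfolding canonical_fractions_def using torus_rep_range by auto

lemma schwartz_continuous: "schwartz \<mm> \<Longrightarrow> continuous_on A (nth_deriv k \<mm>)"
  by (meson continuous_at_imp_continuous_on has_vector_derivative_continuous schwartz_nth_deriv)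

lemma smooth_periodic_periodized:
  assumes "schwartz \<mm>" "closure {x. \<mm> x \<noteq> 0} \<subseteq> {-1/2..1/2}" "0 < \<epsilon>" "\<epsilon> \<le> 1" "R \<subseteq> {-1/2..<1/2}"
  shows "smooth_periodic (periodized \<epsilon> R \<mm>) (\<lambda>\<xi>. of_real (inverse \<epsilon>) * periodized \<epsilon> R (nth_deriv 1 \<mm>) \<xi>)
     (\<lambda>\<xi>. of_real (inverse \<epsilon>) * (of_real (inverse \<epsilon>) * periodized \<epsilon> R (nth_deriv 2 \<mm>) \<xi>))"
proof
  note d = schwartz_nth_deriv[OF assms(1)]
  have d1: "(\<mm> has_vector_derivative nth_deriv 1 \<mm> x) (at x)" for x
    using d[of 0] by (simp add: nth_deriv_0)
  have d2: "(nth_deriv 1 \<mm> has_vector_derivative nth_deriv 2 \<mm> x) (at x)" for x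
    using d[of 1] by (simp add: numeral_2_eq_2)
  show "(periodized \<epsilon> R \<mm> has_vector_derivative of_real (inverse \<epsilon>) * periodized \<epsilon> R (nth_deriv 1 \<mm>) x) (at x)" for x
    by (rule periodized_has_vector_derivative[OF d1])
  show "((\<lambda>\<xi>. of_real (inverse \<epsilon>) * periodized \<epsilon> R (nth_deriv 1 \<mm>) \<xi>) has_vector_derivative
      of_real (inverse \<epsilon>) * (of_real (inverse \<epsilon>) * periodized \<epsilon> R (nth_deriv 2 \<mm>) x)) (at x)" for x
    by (intro has_vector_derivative_mult_right periodized_has_vector_derivative d2)
  show "continuous_on UNIV (\<lambda>\<xi>. of_real (inverse \<epsilon>) * (of_real (inverse \<epsilon>) * periodized \<epsilon> R (nth_deriv 2 \<mm>) \<xi>))"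
    by (intro continuous_intros periodized_continuous schwartz_continuous assms)
  have z0: "\<mm> x = 0" if "\<bar>x\<bar> > 1/2" for x
    using continuous_support_vanishes[of \<mm> x] schwartz_continuous[OF assms(1), of UNIV 0] assms(2) that
    by (simp add: nth_deriv_0)
  have z1: "nth_deriv 1 \<mm> x = 0" if "\<bar>x\<bar> > 1/2" for x
    using vector_derivative_zero_outside[OF d1 z0 that] .
  show "periodized \<epsilon> R \<mm> (1/2) = periodized \<epsilon> R \<mm> (-1/2)"
    by (rule periodized_endpoints) (use assms z0 in auto)
  show "of_real (inverse \<epsilon>) * periodized \<epsilon> R (nth_deriv 1 \<mm>) (1/2) = of_real (inverse \<epsilon>) * periodized \<epsilon> R (nth_deriv 1 \<mm>) (-1/2)"
    using periodized_endpoints[OF assms(5) z1 assms(3,4)] by simp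
qed

lemma Delta_borel_measurable:
  assumes "schwartz \<mm>"
  shows "Delta \<epsilon> R \<mm> \<in> borel_measurable torus"
proof (rule borel_measurable_torusI)
  have [measurable]: "\<mm> \<in> borel_measurable borel"
    using schwartz_continuous[OF assms, of UNIV 0] by (simp add: nth_deriv_0 borel_measurable_continuous_onI)
  show "Delta \<epsilon> R \<mm> \<in> borel_measurable borel"
    unfolding Delta_def torus_rep_def by measurable
qed

lemma Delta_bounded:
  assumes "schwartz \<mm>"
  obtains B where "\<And>\<xi>. norm (Delta \<epsilon> R \<mm> \<xi>) \<le> B"
proof -
  have "bounded (range (\<lambda>x. x ^ 0 *\<^sub>R nth_deriv 0 \<mm> x))" using assms unfolding schwartz_def by blast
  then obtain B where B: "\<And>x. norm (\<mm> x) \<le> B" by (auto simp: bounded_iff nth_deriv_0)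
  show ?thesis
    by (rule that[of "\<Sum>r\<in>R. B"]) (unfold Delta_def, rule order_trans[OF norm_sum], rule sum_mono, rule B)
qed

section \<open>The lower bound\<close>

text \<open>A representative -1/2 would make Q even. The strict bounds put the frequencies where
  Fourier inversion applies.\<close>

lemma torus_rep_odd_denominator:
  fixes b :: int and Q :: nat
  assumes "odd Q"
  shows "-1/2 < torus_rep (of_int b / real Q)" "torus_rep (of_int b / real Q) < 1/2"
proof -
  obtain k where k: "torus_rep (of_int b / real Q) = of_int b / real Q - of_int k"
    by (rule torus_rep_eq_minus_of_int)
  have Q0: "Q > 0" using assms by (cases Q) auto
  have "torus_rep (of_int b / real Q) \<noteq> -1/2"
  proof
    assume "torus_rep (of_int b / real Q) = -1/2"
    then have "real_of_int (int Q) = of_int (2 * (k * int Q - b))"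
      using Q0 unfolding k by (simp add: field_simps)
    then have "int Q = 2 * (k * int Q - b)" by (simp only: of_int_eq_iff)
    then have "even (int Q)" by (rule ssubst) (rule dvd_triv_left)
    then show False using assms by simp
  qed
  then show "-1/2 < torus_rep (of_int b / real Q)" "torus_rep (of_int b / real Q) < 1/2"
    using torus_rep_range[of "of_int b / real Q"] by auto
qed

text \<open>The test function is F, its primitive part is G, and the operator maps F to
  \<open>F - G\<close>. The p-th power sum of G is at least \<open>(1 + \<eta>) ^ card I\<close>
  times that of F, and at most \<open>2 powr p\<close> times those of \<open>F - G\<close> and F
  together; dividing by the positive sum for F gives the claim.\<close>

lemma multiplier_norm_on_step_product:
  fixes p c \<eta> b :: real and I :: "nat set" and \<mm> :: "real \<Rightarrow> complex"
  assumes "1 < p" "0 < \<eta>"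
    and I: "finite I" "\<And>P. P \<in> I \<Longrightarrow> prime P" "\<And>P. P \<in> I \<Longrightarrow> 2 < P"
    and gain: "\<And>P. P \<in> I \<Longrightarrow> (1 + \<eta>) *
       (real (P div 3) * \<bar>1 - real (P div 3) / real P + c\<bar> powr p
         + (real P - real (P div 3)) * \<bar>c - real (P div 3) / real P\<bar> powr p)
       \<le> real (P div 3) * (1 - real (P div 3) / real P) powr p
         + (real P - real (P div 3)) * (real (P div 3) / real P) powr p"
    and N: "\<Prod>I = Suc N" "N \<ge> 1"
    and \<mm>: "schwartz \<mm>" "closure {x. \<mm> x \<noteq> 0} \<subseteq> {-1/2..1/2}" "\<mm> 0 = 1"
    and \<epsilon>: "0 < \<epsilon>" "\<epsilon> \<le> 1 / (real N)\<^sup>2"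
    and b: "b \<ge> 0" "lp_op_norm p (multiplier_op (Delta \<epsilon> (canonical_fractions N) \<mm>)) \<le> ennreal b"
  shows "(1 + \<eta>) ^ card I \<le> 2 powr p * (b powr p + 1)"
proof -
  let ?R = "canonical_fractions N"
  let ?D = "Delta \<epsilon> ?R \<mm>"
  let ?Q = "\<Prod>I"
  define M where "M = periodized \<epsilon> ?R \<mm>"
  define F where "F x = (\<Prod>P\<in>I. mean_zero_step P x + c)" for x
  define G where "G x = (\<Prod>P\<in>I. mean_zero_step P x)" for x
  have Qpos: "?Q > 0" using N by simp
  have Podd: "odd P" if "P \<in> I" for P using I that prime_odd_nat by blast
  have Qodd: "odd ?Q" using I(1) Podd by (simp add: even_prod_iff)
  have "1 / (real N)\<^sup>2 \<le> 1" using N(2) by (simp add: one_le_power)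
  then have \<epsilon>1: "\<epsilon> \<le> 1" using \<epsilon>(2) by linarith
  have supp: "\<mm> x = 0" if "\<bar>x\<bar> \<ge> 1/2" for x
    using continuous_support_vanishes[of \<mm> x] schwartz_continuous[OF \<mm>(1), of UNIV 0] \<mm>(2) that
    by (simp add: nth_deriv_0)
  interpret sp: smooth_periodic M "\<lambda>\<xi>. of_real (inverse \<epsilon>) * periodized \<epsilon> ?R (nth_deriv 1 \<mm>) \<xi>"
    "\<lambda>\<xi>. of_real (inverse \<epsilon>) * (of_real (inverse \<epsilon>) * periodized \<epsilon> ?R (nth_deriv 2 \<mm>) \<xi>)"
    unfolding M_def
    by (rule smooth_periodic_periodized[OF \<mm>(1,2) \<epsilon>(1) \<epsilon>1 canonical_fractions_subset])
  have DM: "?D \<xi> = M \<xi>" if "\<xi> \<in> {-1/2..<1/2}" for \<xi>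
    unfolding M_def by (rule Delta_eq_periodized[OF canonical_fractions_subset supp \<epsilon>(1) \<epsilon>1 that])
  have K: "fourier_Z_inv ?D n = sp.coeff n" for n
    unfolding sp.coeff_def by (rule fourier_Z_inv_eq_integral[OF sp.cont DM])
  obtain B where B: "\<And>\<xi>. norm (?D \<xi>) \<le> B" using Delta_bounded[OF \<mm>(1)] by blast
  have op: "multiplier_op ?D f x = (\<Sum>y\<in>S. f y * sp.coeff (x - y))"
    if "finite S" "\<And>y. y \<notin> S \<Longrightarrow> f y = 0" for f S x
    using multiplier_op_finite[OF that Delta_borel_measurable[OF \<mm>(1)] B] by (simp add: K)
  have bound: "(\<Sum>x\<in>X. cmod (\<Sum>y\<in>S. f y * sp.coeff (x - y)) powr p) \<le> b powr p * (\<Sum>y\<in>S. cmod (f y) powr p)"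
    if "finite S" "finite X" "\<And>y. y \<notin> S \<Longrightarrow> f y = 0" for S X f
  proof -
    have "(\<Sum>x\<in>X. cmod (multiplier_op ?D f x) powr p) \<le> b powr p * (\<Sum>y\<in>S. cmod (f y) powr p)"
      by (rule lp_op_norm_finite_bound[where K = sp.coeff, OF op b(2,1)]) (use that \<open>1 < p\<close> in auto)
    moreover have "multiplier_op ?D f x = (\<Sum>y\<in>S. f y * sp.coeff (x - y))" for x
      by (rule op) (use that in auto)
    ultimately show ?thesis by simp
  qed
  \<comment> \<open>Inversion is available only at the reduced frequency, but at integer arguments a
    character does not notice an integer shift of its frequency.\<close>
  have freq: "((\<lambda>n. sp.coeff n * e_char (- (of_int n * (of_int a / real ?Q)))) has_sum
      (if coprime a (int ?Q) then 0 else 1)) UNIV" for a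
  proof -
    let ?\<theta> = "torus_rep (of_int a / real ?Q)"
    have "M ?\<theta> = ?D ?\<theta>" using DM[OF torus_rep_range] by simp
    also have "\<dots> = (if coprime a (int ?Q) then 0 else 1)"
      by (rule Delta_at_fraction[where \<mm> = \<mm>, OF N \<epsilon> supp \<mm>(3)])
    finally have "((\<lambda>n. sp.coeff n * e_char (- (of_int n * ?\<theta>))) has_sum
      (if coprime a (int ?Q) then 0 else 1)) UNIV"
      using sp.Fourier_inversion[OF torus_rep_odd_denominator[OF Qodd], of a] by (simp only:)
    moreover have "e_char (- (of_int n * ?\<theta>)) = e_char (- (of_int n * (of_int a / real ?Q)))" for n :: int
    proof -
      obtain k where k: "?\<theta> = of_int a / real ?Q - of_int k" by (rule torus_rep_eq_minus_of_int)
      have "- (of_int n * ?\<theta>) = - (of_int n * (of_int a / real ?Q)) + of_int (n * k)"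
        unfolding k by (simp add: algebra_simps)
      then show ?thesis by (simp only: e_char_add e_char_of_int mult_1_right)
    qed
    ultimately show ?thesis by (simp only:)
  qed
  note trig = step_product_trig_poly[OF I(1,2), of c, folded F_def G_def]
  \<comment> \<open>Split \<open>F = G + (F - G)\<close>: the kernel annihilates the primitive part
    and reproduces the rest.\<close>
  have conv: "((\<lambda>n. sp.coeff n * complex_of_real (F (x - n))) has_sum complex_of_real (F x - G x)) UNIV" for x
  proof -
    have "((\<lambda>n. sp.coeff n * complex_of_real (G (x - n))) has_sum (0 * complex_of_real (G x))) UNIV"
    proof (rule trig_poly_convolution)
      show "(\<lambda>x. complex_of_real (G x)) \<in> trig_poly (primitive_freqs ?Q)" using trig by blast
      fix \<theta> assume "\<theta> \<in> primitive_freqs ?Q"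
      then obtain a where "\<theta> = of_int a / real ?Q" "coprime a (int ?Q)"
        unfolding primitive_freqs_def by blast
      then show "((\<lambda>n. sp.coeff n * e_char (- (of_int n * \<theta>))) has_sum 0) UNIV"
        using freq[of a] by (simp only: if_True)
    qed
    moreover have "((\<lambda>n. sp.coeff n * complex_of_real (F (x - n) - G (x - n))) has_sum
        (1 * complex_of_real (F x - G x))) UNIV"
    proof (rule trig_poly_convolution)
      show "(\<lambda>x. complex_of_real (F x - G x)) \<in> trig_poly (imprimitive_freqs ?Q)" using trig by blast
      fix \<theta> assume "\<theta> \<in> imprimitive_freqs ?Q"
      then obtain a where "\<theta> = of_int a / real ?Q" "\<not> coprime a (int ?Q)"
        unfolding imprimitive_freqs_def by blast
      then show "((\<lambda>n. sp.coeff n * e_char (- (of_int n * \<theta>))) has_sum 1) UNIV"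
        using freq[of a] by (simp only: if_False)
    qed
    ultimately have "((\<lambda>n. sp.coeff n * complex_of_real (G (x - n)) + sp.coeff n * complex_of_real (F (x - n) - G (x - n)))
        has_sum (0 * complex_of_real (G x) + 1 * complex_of_real (F x - G x))) UNIV"
      by (rule has_sum_add)
    then show ?thesis by (simp flip: distrib_left)
  qed
  have step_mod: "mean_zero_step P (x mod int P) = mean_zero_step P x" for P x
    by (simp add: mean_zero_step_def)
  have Fper: "F (x mod int ?Q) = F x" for x
    unfolding F_def
  proof (rule prod.cong)
    fix P assume P: "P \<in> I"
    have "int P dvd int ?Q"
      unfolding int_dvd_int_iff using dvd_prodI[OF I(1) P, of "\<lambda>q. q"] by simp
    then have "x mod int ?Q mod int P = x mod int P" by (rule mod_mod_cancel)
    then show "mean_zero_step P (x mod int ?Q) + c = mean_zero_step P x + c" by (metis step_mod)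
  qed simp
  define sF where "sF = (\<Sum>x\<in>{0..<int ?Q}. \<bar>F x\<bar> powr p)"
  define sG where "sG = (\<Sum>x\<in>{0..<int ?Q}. \<bar>G x\<bar> powr p)"
  define sH where "sH = (\<Sum>x\<in>{0..<int ?Q}. \<bar>F x - G x\<bar> powr p)"
  have "(\<Sum>x\<in>{0..<int ?Q}. cmod (complex_of_real (F x - G x)) powr p)
      \<le> b powr p * (\<Sum>x\<in>{0..<int ?Q}. cmod (complex_of_real (F x)) powr p)"
    by (rule periodic_transference[OF Qpos b(1) _ sp.coeff_abs_summable _ conv bound])
      (use Fper \<open>1 < p\<close> in auto)
  then have HF: "sH \<le> b powr p * sF"
    unfolding sH_def sF_def norm_of_real .
  have GH: "sG \<le> 2 powr p * (sH + sF)"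
    unfolding sG_def sH_def sF_def sum.distrib[symmetric] sum_distrib_left
  proof (rule sum_mono)
    fix x
    let ?m = "max \<bar>F x - G x\<bar> \<bar>F x\<bar>"
    have "\<bar>G x\<bar> \<le> \<bar>F x - G x\<bar> + \<bar>F x\<bar>" by linarith
    also have "\<dots> \<le> 2 * ?m" unfolding mult_2 by (intro add_mono max.cobounded1 max.cobounded2)
    finally have "\<bar>G x\<bar> \<le> 2 * ?m" .
    then have "\<bar>G x\<bar> powr p \<le> (2 * ?m) powr p" using \<open>1 < p\<close> by (intro powr_mono2) auto
    also have "\<dots> = 2 powr p * ?m powr p" by (simp add: powr_mult)
    also have "\<dots> \<le> 2 powr p * (\<bar>F x - G x\<bar> powr p + \<bar>F x\<bar> powr p)"
      by (intro mult_left_mono) (auto simp: max_def)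
    finally show "\<bar>G x\<bar> powr p \<le> 2 powr p * (\<bar>F x - G x\<bar> powr p + \<bar>F x\<bar> powr p)" .
  qed
  define s where "s t P = (\<Sum>x\<in>{0..<int P}. \<bar>mean_zero_step P x + t\<bar> powr p)" for t :: real and P
  have prod_s: "(\<Sum>x\<in>{0..<int ?Q}. \<bar>\<Prod>P\<in>I. mean_zero_step P x + t\<bar> powr p) = (\<Prod>P\<in>I. s t P)" for t
  proof -
    have "(\<Sum>x\<in>{0..<int ?Q}. \<Prod>P\<in>I. \<bar>mean_zero_step P x + t\<bar> powr p) = (\<Prod>P\<in>I. s t P)"
      unfolding s_def by (rule sum_prod_prime_periods[OF I(1,2)]) (simp_all add: step_mod)
    then show ?thesis by (simp add: abs_prod prod_powr_distrib)
  qed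
  have s_gain: "(1 + \<eta>) * s c P \<le> s 0 P" and s_pos: "s c P > 0" if P: "P \<in> I" for P
  proof -
    have P0: "P > 0" "P \<ge> 3" using I(3)[OF P] by auto
    note eq = sum_mean_zero_step_powr[OF P0(1), of _ p, folded s_def]
    have frac: "0 \<le> real (P div 3) / real P" "real (P div 3) / real P \<le> 1" using P0 by auto
    show "(1 + \<eta>) * s c P \<le> s 0 P"
      using gain[OF P] frac unfolding eq by simp
    have a: "real (P div 3) > 0" "real P - real (P div 3) > 0" using P0 by auto
    \<comment> \<open>The two values of the shifted step differ by 1, so they cannot both be
      0.\<close>
    have "1 - real (P div 3) / real P + c \<noteq> 0 \<or> c - real (P div 3) / real P \<noteq> 0" by linarith
    then have "0 < \<bar>1 - real (P div 3) / real P + c\<bar> powr p \<or> 0 < \<bar>c - real (P div 3) / real P\<bar> powr p"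
      by simp
    then show "s c P > 0"
      unfolding eq
    proof
      assume "0 < \<bar>1 - real (P div 3) / real P + c\<bar> powr p"
      then show "0 < real (P div 3) * \<bar>1 - real (P div 3) / real P + c\<bar> powr p
          + (real P - real (P div 3)) * \<bar>c - real (P div 3) / real P\<bar> powr p"
        using a by (intro add_pos_nonneg mult_pos_pos mult_nonneg_nonneg) auto
    next
      assume "0 < \<bar>c - real (P div 3) / real P\<bar> powr p"
      then show "0 < real (P div 3) * \<bar>1 - real (P div 3) / real P + c\<bar> powr p
          + (real P - real (P div 3)) * \<bar>c - real (P div 3) / real P\<bar> powr p"
        using a by (intro add_nonneg_pos mult_pos_pos mult_nonneg_nonneg) auto
    qed
  qed
  have sF: "sF = (\<Prod>P\<in>I. s c P)" unfolding sF_def F_def by (rule prod_s)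
  have sG: "sG = (\<Prod>P\<in>I. s 0 P)" using prod_s[of 0] unfolding sG_def G_def by simp
  have "(\<Prod>P\<in>I. (1 + \<eta>) * s c P) \<le> (\<Prod>P\<in>I. s 0 P)"
    by (rule prod_mono) (use s_gain s_pos \<open>0 < \<eta>\<close> in \<open>auto simp: less_imp_le\<close>)
  then have "(1 + \<eta>) ^ card I * sF \<le> sG" unfolding sF sG by (simp add: prod.distrib)
  also have "\<dots> \<le> 2 powr p * (b powr p * sF + sF)"
    using GH HF by (smt (verit, best) mult_left_mono powr_ge_zero)
  also have "\<dots> = 2 powr p * (b powr p + 1) * sF" by (simp add: algebra_simps)
  finally show ?thesis using sF s_pos I(1) by (simp add: prod_pos)
qed

text \<open>Since all primes are at least 5, \<open>N = Q - 1 >= 5^k - 1 >= 4^k >= exp k\<close>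
  with \<open>k = card I\<close>, so \<open>ln k <= ln (ln N)\<close>. Inserting this in
  \<open>ln Q <= 2 k ln k\<close> gives \<open>ln N <= 2 k ln (ln N)\<close>.\<close>

lemma ln_over_ln_ln_le:
  fixes I :: "nat set"
  assumes "finite I" "\<And>q. q \<in> I \<Longrightarrow> 5 \<le> q" "card I \<ge> 2"
    and "ln (real (\<Prod>I)) \<le> 2 * real (card I) * ln (real (card I))"
  shows "ln (real (\<Prod>I - 1)) / ln (ln (real (\<Prod>I - 1))) \<le> 2 * real (card I)"
    and "card I < \<Prod>I - 1"
proof -
  let ?k = "card I" and ?N = "\<Prod>I - 1"
  have "(\<Prod>q\<in>I. 5) \<le> \<Prod>I" by (rule prod_mono) (use assms in auto)
  then have "5 ^ ?k \<le> \<Prod>I" by simp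
  moreover have "(4::nat) ^ ?k < 5 ^ ?k"
    using assms(3) by (intro power_strict_mono) auto
  ultimately have N4: "4 ^ ?k \<le> ?N" by linarith
  show kN: "?k < ?N" using N4 power_gt_expt[of 4 ?k] by linarith
  have "exp (real ?k) = exp 1 ^ ?k" by (simp flip: exp_of_nat_mult)
  also have "\<dots> \<le> 4 ^ ?k" using exp_le by (intro power_mono) auto
  also have "(4::real) ^ ?k \<le> real ?N" using N4 by (metis of_nat_le_iff of_nat_numeral of_nat_power)
  finally have "ln (exp (real ?k)) \<le> ln (real ?N)" using kN by (intro ln_mono) auto
  then have k_le: "real ?k \<le> ln (real ?N)" by simp
  then have ll: "ln (real ?k) \<le> ln (ln (real ?N))" using assms(3) by (intro ln_mono) auto
  have lk: "ln (real ?k) > 0" using assms(3) by simp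
  have "real ?N \<le> real (\<Prod>I)" by (intro of_nat_mono) simp
  moreover have "0 < real ?N" unfolding of_nat_0_less_iff using kN by linarith
  ultimately have "ln (real ?N) \<le> ln (real (\<Prod>I))" by (intro ln_mono)
  also note assms(4)
  also have "2 * real ?k * ln (real ?k) \<le> 2 * real ?k * ln (ln (real ?N))"
    using ll by (intro mult_left_mono) auto
  finally show "ln (real ?N) / ln (ln (real ?N)) \<le> 2 * real ?k"
    using ll lk by (simp add: divide_le_eq)
qed

theorem theorem1p5:
  fixes p :: real
  assumes "1 < p" and "p \<noteq> 2"
  shows "\<exists>c C :: real. 0 < c \<and> c < 1 \<and> 0 < C \<and>
    (\<forall>(\<mm> :: real \<Rightarrow> complex) (\<epsilon> :: nat \<Rightarrow> real).
      schwartz \<mm> \<longrightarrow> closure {x. \<mm> x \<noteq> 0} \<subseteq> {-1/2..1/2} \<longrightarrow> \<mm> 0 = 1 \<longrightarrow>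
      (\<forall>N\<ge>1. 0 < \<epsilon> N \<and> \<epsilon> N \<le> real N powr (-2)) \<longrightarrow>
      infinite {N. 1 \<le> N \<and>
        lp_op_norm p (multiplier_op (Delta (\<epsilon> N) (canonical_fractions N) \<mm>))
          \<ge> ennreal (C * real N powr (c / ln (ln (real N))))})"
proof -
  obtain c \<eta> P0 where \<eta>: "0 < \<eta>" "\<eta> < 1" and gain: "\<And>P. P > P0 \<Longrightarrow> (1 + \<eta>) *
       (real (P div 3) * \<bar>1 - real (P div 3) / real P + c\<bar> powr p
         + (real P - real (P div 3)) * \<bar>c - real (P div 3) / real P\<bar> powr p)
       \<le> real (P div 3) * (1 - real (P div 3) / real P) powr p
         + (real P - real (P div 3)) * (real (P div 3) / real P) powr p"
    using uniform_shift_gain[OF assms] by blast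
  define L where "L = ln (1 + \<eta>)"
  \<comment> \<open>Since \<open>ln N / ln (ln N) <= 2 k\<close>, this makes the p-th power of the
    claimed bound at most \<open>exp (k L / 2)\<close>, the square root of the gain
    \<open>(1 + \<eta>)^k = exp (k L)\<close>.\<close>
  define c0 where "c0 = L / (4 * p)"
  have L: "L > 0" "L < 1" using \<eta> ln_add_one_self_le_self[of \<eta>] by (auto simp: L_def)
  have c0: "0 < c0" "c0 < 1" using L assms(1) by (auto simp: c0_def field_simps)
  show ?thesis
  proof (rule exI[of _ c0], rule exI[of _ 1], intro conjI allI impI c0)
    fix \<mm> :: "real \<Rightarrow> complex" and \<epsilon> :: "nat \<Rightarrow> real"
    assume \<mm>: "schwartz \<mm>" "closure {x. \<mm> x \<noteq> 0} \<subseteq> {-1/2..1/2}" "\<mm> 0 = 1"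
      and \<epsilon>: "\<forall>N\<ge>1. 0 < \<epsilon> N \<and> \<epsilon> N \<le> real N powr (-2)"
    show "infinite {N. 1 \<le> N \<and>
        lp_op_norm p (multiplier_op (Delta (\<epsilon> N) (canonical_fractions N) \<mm>))
          \<ge> ennreal (1 * real N powr (c0 / ln (ln (real N))))}"
      unfolding infinite_nat_iff_unbounded_le
    proof
      fix n0 :: nat
      \<comment> \<open>The summand n0 forces \<open>N >= n0\<close>, the 2 makes
        \<open>ln k\<close> positive, and the last one makes \<open>exp (k L / 2)\<close> exceed
        \<open>2 * 2 powr p\<close>. Large k thus absorbs all constants, which allows
        \<open>C = 1\<close>.\<close>
      define K where "K = n0 + 2 + nat \<lceil>2 * (p + 1) * ln 2 / L\<rceil>"
      obtain I where I: "finite I" "\<And>q. q \<in> I \<Longrightarrow> prime q \<and> P0 + 5 < q" "K \<le> card I"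
        "ln (real (\<Prod>I)) \<le> 2 * real (card I) * ln (real (card I))"
        using many_primes_small_product[of "P0 + 5" K] by blast
      define k where "k = card I"
      define N where "N = \<Prod>I - 1"
      have "5 \<le> q" if "q \<in> I" for q using I(2)[OF that] by simp
      moreover have "2 \<le> card I" using I(3) by (simp add: K_def)
      ultimately have N: "ln (real N) / ln (ln (real N)) \<le> 2 * real k" "k < N"
        using ln_over_ln_ln_le[OF I(1) _ _ I(4)] unfolding N_def k_def by auto
      have NS: "\<Prod>I = Suc N" using N(2) unfolding N_def by simp
      define b where "b = real N powr (c0 / ln (ln (real N)))"
      have "b = exp (c0 * (ln (real N) / ln (ln (real N))))"
        using N(2) by (simp add: b_def powr_def)
      also have "\<dots> \<le> exp (c0 * (2 * real k))"
        unfolding exp_le_cancel_iff using N(1) c0 by (intro mult_left_mono) auto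
      finally have "b powr p \<le> exp (c0 * (2 * real k)) powr p"
        using assms(1) by (intro powr_mono2) (auto simp: b_def)
      also have "\<dots> = exp (real k * L / 2)"
        using assms(1) by (simp add: powr_def c0_def)
      finally have bp: "b powr p \<le> exp (real k * L / 2)" .
      have "lp_op_norm p (multiplier_op (Delta (\<epsilon> N) (canonical_fractions N) \<mm>)) \<ge> ennreal b"
      \<comment> \<open>The negation supplies the finite norm bound b. With
        \<open>y = exp (k L / 2)\<close> it leads to
        \<open>y^2 <= 2 powr p * (b powr p + 1) <= 2 powr p * (2 y) < y^2\<close>.\<close>
      proof (rule ccontr)
        assume "\<not> ?thesis"
        then have le: "lp_op_norm p (multiplier_op (Delta (\<epsilon> N) (canonical_fractions N) \<mm>)) \<le> ennreal b"
          by simp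
        have eN: "0 < \<epsilon> N" "\<epsilon> N \<le> 1 / (real N)\<^sup>2"
          using \<epsilon> N(2) by (auto simp: powr_minus_divide)
        have "(1 + \<eta>) ^ card I \<le> 2 powr p * (b powr p + 1)"
        proof (rule multiplier_norm_on_step_product[OF assms(1) \<eta>(1) I(1) _ _ _ NS _ \<mm> eN _ le])
          show "b \<ge> 0" by (simp add: b_def)
          show "N \<ge> 1" using N(2) by simp
          fix P assume P: "P \<in> I"
          have "P0 < P" using I(2)[OF P] by simp
          then show "(1 + \<eta>) *
             (real (P div 3) * \<bar>1 - real (P div 3) / real P + c\<bar> powr p
               + (real P - real (P div 3)) * \<bar>c - real (P div 3) / real P\<bar> powr p)
             \<le> real (P div 3) * (1 - real (P div 3) / real P) powr p
               + (real P - real (P div 3)) * (real (P div 3) / real P) powr p"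
            by (rule gain)
          show "prime P" "2 < P" using I(2)[OF P] by simp_all
        qed
        moreover have "(1 + \<eta>) ^ card I = exp (real k * L / 2) * exp (real k * L / 2)"
        proof -
          have "(1 + \<eta>) ^ card I = exp (real k * L)"
            using \<eta> by (simp add: L_def k_def exp_of_nat_mult)
          then show ?thesis by (simp flip: exp_add)
        qed
        moreover have "2 * 2 powr p < exp (real k * L / 2)"
        proof -
          have "2 * (p + 1) * ln 2 / L < real K" unfolding K_def by linarith
          also have "real K \<le> real k" using I(3) by (simp add: k_def)
          finally have "(p + 1) * ln 2 < real k * L / 2" using L by (simp add: field_simps)
          then have "exp ((p + 1) * ln 2) < exp (real k * L / 2)" by simp
          moreover have "exp ((p + 1) * ln 2) = 2 * 2 powr p"
            by (simp add: powr_def distrib_right exp_add)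
          ultimately show ?thesis by simp
        qed
        moreover have "1 < exp (real k * L / 2)" using N(2) L I(3) by (simp add: K_def k_def)
        ultimately show False
        proof -
          let ?y = "exp (real k * L / 2)"
          assume a: "(1 + \<eta>) ^ card I \<le> 2 powr p * (b powr p + 1)" "(1 + \<eta>) ^ card I = ?y * ?y"
            "2 * 2 powr p < ?y" "1 < ?y"
          have "b powr p + 1 \<le> 2 * ?y" using bp a(4) by linarith
          then have "2 powr p * (b powr p + 1) \<le> 2 powr p * (2 * ?y)"
            by (intro mult_left_mono) auto
          also have "\<dots> = (2 * 2 powr p) * ?y" by simp
          also have "\<dots> < ?y * ?y" using a(3) by (intro mult_strict_right_mono) auto
          finally show False using a(1,2) by linarith
        qed
      qed
      then show "\<exists>N\<ge>n0. N \<in> {N. 1 \<le> N \<and>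
        lp_op_norm p (multiplier_op (Delta (\<epsilon> N) (canonical_fractions N) \<mm>))
          \<ge> ennreal (1 * real N powr (c0 / ln (ln (real N))))}"
        using N(2) I(3) unfolding b_def k_def K_def
        by (intro exI[of _ N]) auto
    qed
  qed simp
qed

end
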